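(* Let $X=(X_n)_{n\ge 0}$ be a stationary stochastic process over a finite alphabet $\mathcal{A}$ with stationary measure $\mu$ on $\mathcal{A}^{\mathbb{N}}$, and let $f$ be the run-length encoder. Assume that: (i) $\underline{H}_2(f_*\mu)>0$; (ii) there exist $c>0$ and $h>0$ such that $\mu(\underbrace{a\cdots a}_{n})\le c\,e^{-hn}$ for every $n\ge 1$ and every $a\in\mathcal{A}$; (iii) the process is $\alpha$-mixing with exponential decay, or it is $\psi$-mixing with $\psi(g)=g^{-a}$ for some $a>0$. Then for $\mu\otimes\mu$-almost every pair $(\mathbf{x},\mathbf{y})$, $$\liminf_{n\to\infty}\frac{M_n^{RLE}(\mathbf{x},\mathbf{y})}{\log n}\ge\frac{2}{\overline{H}_2(f_*\mu)}.$$ Consequently, if the Rényi entropy $H_2(f_*\mu)$ exists (that is, $\underline{H}_2(f_*\mu)=\overline{H}_2(f_*\mu)=:H_2(f_*\mu)$), then for $\mu\otimes\mu$-almost every $(\mathbf{x},\mathbf{y})$, $$\lim_{n\to\infty}\frac{M_n^{RLE}(\mathbf{x},\mathbf{y})}{\log n}=\frac{2}{H_2(f_*\mu)}.$$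
   Context: Sequences are indexed from $0$. For a finite string $\omega$ of length $k$ over $\mathcal{A}$, $\mu(\omega)$ denotes $\mu(X_i^{i+k-1}=\omega)$, which does not depend on $i$ by stationarity; here $z_i^{i+k-1}=(z_i,\dots,z_{i+k-1})$. Run-length encoder: let $\mathcal{B}=\{(\alpha,k):\alpha\in\mathcal{A},\ k\in\mathbb{N},\ k\ge 1\}$. A sequence in $\mathcal{A}^{\mathbb{N}}$ that is not eventually constant is written uniquely as a concatenation of maximal runs, $\alpha_1$ repeated $k_1$ times, then $\alpha_2$ repeated $k_2$ times, and so on, with $\alpha_{i+1}\ne\alpha_i$ for all $i$. The encoder $f$ maps it to $(\alpha_1,k_1)(\alpha_2,k_2)\cdots\in\mathcal{B}^{\mathbb{N}}$. (Under assumption (ii), $\mu$-almost every sequence is not eventually constant, so $f$ is defined $\mu$-a.e.) The pushforward measure is $f_*\mu(\cdot)=\mu(f^{-1}(\cdot))$. For $\omega\in\mathcal{B}^n$, $f_*\mu(\omega)$ is the $\mu$-probability that the first $n$ symbols of $f(X)$ are $\omega$. Longest common substring: for two sequences $\mathbf{u},\mathbf{v}$ over the same alphabet, $$M_n(\mathbf{u},\mathbf{v})=\max\{k:\ \mathbf{u}_i^{i+k-1}=\mathbf{v}_j^{j+k-1}\text{ for some }0\le i,j\le n-k\}$$ (with $k=0$ always allowed), that is, the greatest length of a common block contained in the first $n$ symbols of each sequence. Set $M_n^{RLE}(\mathbf{x},\mathbf{y}):=M_n(f(\mathbf{x}),f(\mathbf{y}))$. Lower and upper Rényi entropies of order $2$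 of $P=f_*\mu$: $$\underline{H}_2(P)=\liminf_{n\to\infty}\Big(-\frac1n\log\sum_{\omega\in\mathcal{B}^n}P(\omega)^2\Big),\qquad \overline{H}_2(P)=\limsup_{n\to\infty}\Big(-\frac1n\log\sum_{\omega\in\mathcal{B}^n}P(\omega)^2\Big).$$ By convention $2/\infty=0$. Mixing: for $0\le J\le L\le\infty$ let $\mathcal{F}_J^L=\sigma(X_k,\ J\le k\le L)$. The process is $\alpha$-mixing if there is a function $\alpha:\mathbb{N}\to\mathbb{R}$ with $\alpha(g)\to0$ as $g\to\infty$ such that for all $n$ and $g$, $$\sup_{A\in\mathcal{F}_0^n,\ B\in\mathcal{F}_{n+g}^\infty}|\mu(A\cap B)-\mu(A)\mu(B)|\le\alpha(g);$$ it has exponential decay if $\alpha(g)$ can be taken to decrease exponentially fast to $0$. The process is $\psi$-mixing if there is a function $\psi$ with $\psi(g)\to0$ as $g\to\infty$ such that for all $n$ and $g$, $$\sup_{A\in\mathcal{F}_0^n,\ B\in\mathcal{F}_{n+g}^\infty}\left|\frac{\mu(A\cap B)-\mu(A)\mu(B)}{\mu(A)\mu(B)}\right|\le\psi(g),$$ the supremum being over events of positive measure. For $\psi(g)=g^{-a}$ the bound is required for $g\ge1$. *)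

theory Defs
  imports "HOL-Probability.Probability"
begin

section \<open>Stationary processes over a finite alphabet\<close>

text \<open>A process is represented by its law on sequence space, with the coordinate maps as the
  random variables \<open>X_k\<close>.\<close>

definition seq_space :: "(nat \<Rightarrow> 'b) measure" where
  "seq_space = PiM UNIV (\<lambda>_. count_space UNIV)"

definition stationary_process :: "(nat \<Rightarrow> 'a::finite) measure \<Rightarrow> bool" where
  "stationary_process M \<longleftrightarrow>
     prob_space M \<and> sets M = sets seq_space \<and> distr M M (\<lambda>x n. x (Suc n)) = M"

definition block :: "(nat \<Rightarrow> 'b) \<Rightarrow> nat \<Rightarrow> nat \<Rightarrow> 'b list" where
  "block z i k = map z [i..<i + k]"

definition word_prob :: "(nat \<Rightarrow> 'b) measure \<Rightarrow> 'b list \<Rightarrow> real" where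
  "word_prob P w = measure P {z \<in> space P. block z 0 (length w) = w}"

section \<open>Run-length encoding\<close>

primrec run_start :: "(nat \<Rightarrow> 'a) \<Rightarrow> nat \<Rightarrow> nat" where
  "run_start x 0 = 0"
| "run_start x (Suc i) = (LEAST j. run_start x i < j \<and> x j \<noteq> x (run_start x i))"

text \<open>On eventually constant sequences, where the encoder is undefined in the mathematics, the
  value below is meaningless. There are only countably many such sequences, so \<open>rle\<close> is still
  measurable (\<open>measurable_rle\<close>); \<open>run_decomposition_iff_rle\<close> shows that it is the encoder on
  all other sequences.\<close>

definition rle :: "(nat \<Rightarrow> 'a) \<Rightarrow> nat \<Rightarrow> 'a \<times> nat" where
  "rle x i = (x (run_start x i), run_start x (Suc i) - run_start x i)"

definition rle_alphabet :: "('a \<times> nat) set" where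
  "rle_alphabet = {(\<alpha>, k). k \<ge> 1}"

definition run_decomposition :: "(nat \<Rightarrow> 'a) \<Rightarrow> (nat \<Rightarrow> 'a \<times> nat) \<Rightarrow> bool" where
  "run_decomposition x r \<longleftrightarrow>
     (\<forall>i. r i \<in> rle_alphabet) \<and> (\<forall>i. fst (r (Suc i)) \<noteq> fst (r i)) \<and>
     (\<forall>i. \<forall>j < snd (r i). x ((\<Sum>l<i. snd (r l)) + j) = fst (r i))"

definition eventually_constant :: "(nat \<Rightarrow> 'a) \<Rightarrow> bool" where
  "eventually_constant x \<longleftrightarrow> (\<exists>N a. \<forall>n\<ge>N. x n = a)"

lemma run_start_Suc:
  assumes "\<not> eventually_constant x"
  shows "run_start x i < run_start x (Suc i)"
    and "x (run_start x (Suc i)) \<noteq> x (run_start x i)"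
    and "\<And>j. run_start x i \<le> j \<Longrightarrow> j < run_start x (Suc i) \<Longrightarrow> x j = x (run_start x i)"
proof -
  let ?P = "\<lambda>j. run_start x i < j \<and> x j \<noteq> x (run_start x i)"
  have "\<exists>j. ?P j"
    using assms unfolding eventually_constant_def by (metis le_neq_implies_less)
  then have "?P (LEAST j. ?P j)"
    by (rule LeastI_ex)
  then show "run_start x i < run_start x (Suc i)"
    and "x (run_start x (Suc i)) \<noteq> x (run_start x i)"
    by auto
  fix j assume j: "run_start x i \<le> j" "j < run_start x (Suc i)"
  then have "\<not> ?P j"
    using not_less_Least[of j ?P] by simp
  with j show "x j = x (run_start x i)"
    by (cases "j = run_start x i") auto
qed

lemma run_decomposition_iff_rle:
  assumes nec: "\<not> eventually_constant x"
  shows "run_decomposition x r \<longleftrightarrow> r = rle x"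
proof
  have sum: "(\<Sum>l<i. snd (rle x l)) = run_start x i" for i
  proof (induction i)
    case (Suc i)
    then show ?case
      using run_start_Suc(1)[OF nec, of i] by (simp add: rle_def del: run_start.simps(2))
  qed simp
  assume "r = rle x"
  moreover have "x (run_start x i + j) = x (run_start x i)"
    if "j < run_start x (Suc i) - run_start x i" for i j
    using that by (intro run_start_Suc(3)[OF nec]) auto
  ultimately show "run_decomposition x r"
    unfolding run_decomposition_def
    using run_start_Suc(1,2)[OF nec] sum
    by (auto simp: rle_def rle_alphabet_def Suc_le_eq simp del: run_start.simps(2))
next
  assume r: "run_decomposition x r"
  define S where "S i = (\<Sum>l<i. snd (r l))" for i
  have pos: "snd (r i) \<ge> 1" for i
  proof -
    have "r i \<in> rle_alphabet"
      using r by (simp add: run_decomposition_def)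
    then show ?thesis
      by (auto simp: rle_alphabet_def)
  qed
  have S_Suc: "S (Suc i) = S i + snd (r i)" for i
    by (simp add: S_def)
  have val: "x (S i + j) = fst (r i)" if "j < snd (r i)" for i j
    using r that by (simp add: run_decomposition_def S_def)
  have val0: "x (S i) = fst (r i)" for i
    using val[of 0 i] pos[of i] by simp
  have ne: "fst (r (Suc i)) \<noteq> fst (r i)" for i
    using r by (simp add: run_decomposition_def)
  have start: "run_start x i = S i" for i
  proof (induction i)
    case 0
    show ?case by (simp add: S_def)
  next
    case (Suc i)
    have "(LEAST j. S i < j \<and> x j \<noteq> x (S i)) = S (Suc i)"
    proof (rule Least_equality)
      show "S i < S (Suc i) \<and> x (S (Suc i)) \<noteq> x (S i)"
        using pos[of i] ne[of i] val0[of i] val0[of "Suc i"] by (auto simp: S_Suc)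
      fix j assume j: "S i < j \<and> x j \<noteq> x (S i)"
      show "S (Suc i) \<le> j"
      proof (rule ccontr)
        assume "\<not> S (Suc i) \<le> j"
        then have "x (S i + (j - S i)) = fst (r i)"
          using j by (intro val) (auto simp: S_Suc)
        then show False
          using j val0 by simp
      qed
    qed
    with Suc show ?case by simp
  qed
  show "r = rle x"
    by (rule ext) (simp add: rle_def start S_Suc val0 del: run_start.simps(2))
qed

lemma measurable_run_start:
  "(\<lambda>x. run_start x i) \<in> measurable (seq_space :: (nat \<Rightarrow> 'a::finite) measure) (count_space UNIV)"
proof (induction i)
  case (Suc i)
  note [measurable] = Suc
  have [measurable]: "(\<lambda>x. x k) \<in> measurable (seq_space :: (nat \<Rightarrow> 'a) measure) (count_space UNIV)" for k
    unfolding seq_space_def by measurable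
  have [measurable]: "(\<lambda>x. x (run_start x i)) \<in> measurable (seq_space :: (nat \<Rightarrow> 'a) measure) (count_space UNIV)"
    by (rule measurable_compose_countable'[where I = UNIV]) auto
  show ?case
    unfolding run_start.simps by measurable
qed simp

lemma measurable_rle: "rle \<in> measurable (seq_space :: (nat \<Rightarrow> 'a::finite) measure) seq_space"
proof -
  note [measurable] = measurable_run_start
  have [measurable]: "(\<lambda>x. x k) \<in> measurable (seq_space :: (nat \<Rightarrow> 'a) measure) (count_space UNIV)" for k
    unfolding seq_space_def by measurable
  have [measurable]: "(\<lambda>x. x (run_start x i)) \<in> measurable (seq_space :: (nat \<Rightarrow> 'a) measure) (count_space UNIV)" for i
    by (rule measurable_compose_countable'[where I = UNIV]) auto
  have "(\<lambda>x. rle x i) \<in> measurable (seq_space :: (nat \<Rightarrow> 'a) measure) (count_space UNIV)" for i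
    unfolding rle_def by measurable
  then show ?thesis
    unfolding seq_space_def[where 'b = "'a \<times> nat"]
    by (intro measurable_PiM_single') (auto simp: space_PiM)
qed

definition rle_law :: "(nat \<Rightarrow> 'a::finite) measure \<Rightarrow> (nat \<Rightarrow> 'a \<times> nat) measure" where
  "rle_law M = distr M seq_space rle"

section \<open>Longest common substring\<close>

definition longest_common :: "nat \<Rightarrow> (nat \<Rightarrow> 'b) \<Rightarrow> (nat \<Rightarrow> 'b) \<Rightarrow> nat" where
  "longest_common n u v =
     Max {k. \<exists>i j. i + k \<le> n \<and> j + k \<le> n \<and> block u i k = block v j k}"

definition longest_common_rle :: "nat \<Rightarrow> (nat \<Rightarrow> 'a) \<Rightarrow> (nat \<Rightarrow> 'a) \<Rightarrow> nat" where
  "longest_common_rle n x y = longest_common n (rle x) (rle y)"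

section \<open>Renyi entropies of order 2\<close>

text \<open>For a process over the countable alphabet \<open>B\<close>. The entropies may be infinite, so they are
  extended reals; division in \<^typ>\<open>ereal\<close> satisfies \<open>2 / \<infinity> = 0\<close>.\<close>

definition collision_rate :: "'b set \<Rightarrow> (nat \<Rightarrow> 'b) measure \<Rightarrow> nat \<Rightarrow> real" where
  "collision_rate B P n =
     - (1 / real n) * ln (\<Sum>\<^sub>\<infinity> w \<in> {w. length w = n \<and> set w \<subseteq> B}. (word_prob P w)\<^sup>2)"

definition lower_renyi2 :: "'b set \<Rightarrow> (nat \<Rightarrow> 'b) measure \<Rightarrow> ereal" where
  "lower_renyi2 B P = liminf (\<lambda>n. ereal (collision_rate B P n))"

definition upper_renyi2 :: "'b set \<Rightarrow> (nat \<Rightarrow> 'b) measure \<Rightarrow> ereal" where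
  "upper_renyi2 B P = limsup (\<lambda>n. ereal (collision_rate B P n))"

section \<open>Mixing\<close>

definition coord_sigma :: "nat \<Rightarrow> enat \<Rightarrow> (nat \<Rightarrow> 'a) set set" where
  "coord_sigma J L = sigma_sets UNIV {{x. x k \<in> S} | k S. J \<le> k \<and> enat k \<le> L}"

definition alpha_mixing :: "(nat \<Rightarrow> 'a) measure \<Rightarrow> (nat \<Rightarrow> real) \<Rightarrow> bool" where
  "alpha_mixing M \<alpha> \<longleftrightarrow> \<alpha> \<longlonglongrightarrow> 0 \<and>
     (\<forall>n g. \<forall>A \<in> coord_sigma 0 (enat n). \<forall>B \<in> coord_sigma (n + g) \<infinity>.
        \<bar>measure M (A \<inter> B) - measure M A * measure M B\<bar> \<le> \<alpha> g)"

definition alpha_mixing_exponential :: "(nat \<Rightarrow> 'a) measure \<Rightarrow> bool" where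
  "alpha_mixing_exponential M \<longleftrightarrow>
     (\<exists>\<alpha>. alpha_mixing M \<alpha> \<and> (\<exists>C \<kappa>. \<kappa> > 0 \<and> (\<forall>g. \<alpha> g \<le> C * exp (- \<kappa> * real g))))"

text \<open>The bound is imposed only for \<open>g \<ge> 1\<close>, because the rates of interest \<open>g powr (- a)\<close>
  blow up at \<open>0\<close> (whereas \<open>0 powr (- a) = 0\<close> in the library).\<close>

definition psi_mixing :: "(nat \<Rightarrow> 'a) measure \<Rightarrow> (nat \<Rightarrow> real) \<Rightarrow> bool" where
  "psi_mixing M \<psi> \<longleftrightarrow> \<psi> \<longlonglongrightarrow> 0 \<and>
     (\<forall>n. \<forall>g\<ge>1. \<forall>A \<in> coord_sigma 0 (enat n). \<forall>B \<in> coord_sigma (n + g) \<infinity>.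
        measure M A > 0 \<longrightarrow> measure M B > 0 \<longrightarrow>
        \<bar>(measure M (A \<inter> B) - measure M A * measure M B) / (measure M A * measure M B)\<bar> \<le> \<psi> g)"

end

theory Submission
  imports Defs "HOL-Real_Asymp.Real_Asymp"
begin

text \<open>A block of length \<open>k\<close> common to the encodings corresponds to two positions from which \<open>x\<close> and
  \<open>y\<close> have the same first \<open>k\<close> runs. Stationarity of \<open>M\<close> on the original sequence makes the
  probability of this event, for given positions, equal to the collision probability
  \<open>Z k = (\<Sum>w. P(w)\<^sup>2)\<close> for the law \<open>P\<close> of the encoding, although \<open>P\<close> itself is not stationary. Long runs are
  exponentially rare, so with \<open>r = n\<^sup>\<delta>\<close> the first \<open>n\<close> runs end before position \<open>n r\<close> and
  \<open>k\<close> runs fit into a window of length \<open>k r\<close>, up to superpolynomially small probabilities.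

  Upper bound: a union bound over \<open>(n r + 1)\<^sup>2\<close> pairs of positions. Lower bound: the second moment
  method for the number of coincidences among windows separated by gaps. Both mixing hypotheses
  are used only through the common consequence
  \<open>M(A \<inter> B) \<le> (1 + g\<^sup>-\<^sup>a) M(A) M(B) + C exp(- \<kappa> g)\<close>. Both exceptional probabilities
  decay polynomially in \<open>n\<close>, so Borel--Cantelli along \<open>n = 2\<^sup>l\<close> and monotonicity in \<open>n\<close>
  finish the proof.\<close>

section \<open>Run starts and shifts\<close>

declare run_start.simps(2) [simp del]

definition shift :: "nat \<Rightarrow> (nat \<Rightarrow> 'b) \<Rightarrow> nat \<Rightarrow> 'b" where
  "shift s x = (\<lambda>j. x (s + j))"

lemma shift_0 [simp]: "shift 0 x = x"
  by (simp add: shift_def)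

lemma eventually_constant_shift [simp]: "eventually_constant (shift s x) \<longleftrightarrow> eventually_constant x"
proof
  assume "eventually_constant (shift s x)"
  then obtain N a where *: "\<And>n. n \<ge> N \<Longrightarrow> x (s + n) = a"
    unfolding eventually_constant_def shift_def by blast
  have "x n = a" if "n \<ge> s + N" for n
    using *[of "n - s"] that by simp
  then show "eventually_constant x"
    unfolding eventually_constant_def by blast
next
  assume "eventually_constant x"
  then obtain N a where "\<And>n. n \<ge> N \<Longrightarrow> x n = a"
    unfolding eventually_constant_def by blast
  then show "eventually_constant (shift s x)"
    unfolding eventually_constant_def shift_def by (intro exI[of _ N] exI[of _ a]) simp
qed

lemma block_eq_iff: "block u i k = block v j k \<longleftrightarrow> (\<forall>l<k. u (i + l) = v (j + l))"
  by (auto simp: block_def list_eq_iff_nth_eq)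

lemma block_eq_word_iff: "block z i k = w \<longleftrightarrow> length w = k \<and> (\<forall>j<k. z (i + j) = w ! j)"
  unfolding block_def list_eq_iff_nth_eq by auto

lemma length_block [simp]: "length (block z i k) = k"
  by (simp add: block_def)

lemma run_start_Suc_eqI:
  assumes "run_start x i = p" "p < q" "x q \<noteq> x p" "\<And>j. p \<le> j \<Longrightarrow> j < q \<Longrightarrow> x j = x p"
  shows "run_start x (Suc i) = q"
  unfolding run_start.simps(2) assms(1)
proof (rule Least_equality)
  show "q \<le> j" if "p < j \<and> x j \<noteq> x p" for j
    using assms(4)[of j] that by (cases "j < q") auto
qed (use assms(2,3) in auto)

context
  fixes x :: "nat \<Rightarrow> 'a"
  assumes nec: "\<not> eventually_constant x"
begin

lemma strict_mono_run_start: "strict_mono (run_start x)"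
  using run_start_Suc(1)[OF nec] by (simp add: strict_mono_Suc_iff)

lemma run_start_mono: "i \<le> j \<Longrightarrow> run_start x i \<le> run_start x j"
  using strict_mono_run_start by (simp add: strict_mono_less_eq)

lemma sum_list_block_rle:
  "sum_list (map snd (block (rle x) i k)) = run_start x (i + k) - run_start x i"
proof (induction k)
  case (Suc k)
  then show ?case
    using run_start_Suc(1)[OF nec, of "i + k"] run_start_mono[of i "i + k"]
    by (simp add: block_def rle_def)
qed (simp add: block_def)

lemma block_rle_subset: "set (block (rle x) i k) \<subseteq> rle_alphabet"
  using run_start_Suc(1)[OF nec]
  by (auto simp: block_def rle_def rle_alphabet_def Suc_le_eq)

text \<open>Cutting inside the \<open>i\<close>-th run shortens that run only, and every later run
  boundary stays where it was. Start \<open>0\<close> of the shifted sequence is the cut itself,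
  hence the index \<open>Suc j\<close>.\<close>

lemma run_start_shift:
  assumes s: "run_start x i \<le> s" "s < run_start x (Suc i)"
  shows "s + run_start (shift s x) (Suc j) = run_start x (i + Suc j)"
proof (induction j)
  case 0
  have "run_start (shift s x) (Suc 0) = run_start x (Suc i) - s"
  proof (rule run_start_Suc_eqI)
    show "run_start (shift s x) 0 = 0" by simp
    have "x s = x (run_start x i)"
      using run_start_Suc(3)[OF nec] s by blast
    then show "0 < run_start x (Suc i) - s"
      and "shift s x (run_start x (Suc i) - s) \<noteq> shift s x 0"
      using run_start_Suc(2)[OF nec, of i] s by (simp_all add: shift_def)
    show "shift s x j = shift s x 0" if "j < run_start x (Suc i) - s" for j
      using run_start_Suc(3)[OF nec, of i "s + j"] \<open>x s = _\<close> s that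
      by (simp add: shift_def)
  qed
  with s show ?case by (simp)
next
  case (Suc j)
  let ?p = "run_start (shift s x) (Suc j)" and ?i = "i + Suc j"
  have "run_start (shift s x) (Suc (Suc j)) = run_start x (Suc ?i) - s"
  proof (rule run_start_Suc_eqI)
    show "run_start (shift s x) (Suc j) = ?p" by simp
    show "?p < run_start x (Suc ?i) - s"
      using run_start_Suc(1)[OF nec, of ?i] Suc by (simp)
    show "shift s x (run_start x (Suc ?i) - s) \<noteq> shift s x ?p"
      using run_start_Suc(1,2)[OF nec, of ?i] Suc
      by (simp add: shift_def)
    show "shift s x l = shift s x ?p" if "?p \<le> l" "l < run_start x (Suc ?i) - s" for l
      using run_start_Suc(3)[OF nec, of ?i "s + l"] Suc that
      by (simp add: shift_def)
  qed
  then show ?case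
    using run_start_Suc(1)[OF nec, of ?i] Suc by (simp)
qed

text \<open>A cut at a run boundary removes whole runs, so here even the first symbol of the
  encoding survives.\<close>

lemma rle_shift_run_start: "rle (shift (run_start x i) x) j = rle x (i + j)"
proof -
  have *: "run_start x i + run_start (shift (run_start x i) x) l = run_start x (i + l)" for l
    using run_start_shift[of i "run_start x i"] run_start_Suc(1)[OF nec, of i]
    by (cases l) (simp_all)
  have "rle (shift (run_start x i) x) j =
      (x (run_start x (i + j)),
       run_start x i + run_start (shift (run_start x i) x) (Suc j)
         - (run_start x i + run_start (shift (run_start x i) x) j))"
    by (simp add: rle_def *[of j, symmetric]) (simp add: shift_def)
  then show ?thesis
    by (simp add: * rle_def)
qed

text \<open>\<open>i\<close> is the index of the run containing \<open>s\<close>. Every run has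
  length at least one, so \<open>i \<le> s\<close>; this turns bounds on positions into bounds on
  run indices. The cut may truncate the first code symbol, so the encodings are compared from the
  second one on.\<close>

lemma rle_shift_Suc:
  obtains i where "i \<le> s" "\<And>j. rle (shift s x) (Suc j) = rle x (i + Suc j)"
proof -
  have "s < run_start x (Suc s)"
    using strict_mono_imp_increasing[OF strict_mono_run_start, of "Suc s"] by simp
  then obtain i where i: "run_start x i \<le> s" "s < run_start x (Suc i)"
    using ex_least_nat_less[of "\<lambda>i. s < run_start x i" "Suc s"]
    by (auto simp: not_less)
  have i_le: "i \<le> s"
    using strict_mono_imp_increasing[OF strict_mono_run_start, of i] i(1) by simp
  have "rle (shift s x) (Suc j) = rle x (i + Suc j)" for j
  proof -
    have "rle (shift s x) (Suc j) =
        (x (s + run_start (shift s x) (Suc j)),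
         s + run_start (shift s x) (Suc (Suc j)) - (s + run_start (shift s x) (Suc j)))"
      by (simp add: rle_def shift_def)
    then show ?thesis
      unfolding run_start_shift[OF i] rle_def by simp
  qed
  with i_le that show thesis by blast
qed

text \<open>A run start is recognized by the change of symbol at that very place. Agreement on the
  closed interval from 0 to \<open>W\<close> therefore fixes all run starts up to
  \<open>W\<close>.\<close>

lemma run_start_cong:
  assumes nec': "\<not> eventually_constant x'"
    and agree: "\<And>j. j \<le> W \<Longrightarrow> x j = x' j" and fit: "run_start x k \<le> W" and "i \<le> k"
  shows "run_start x' i = run_start x i"
  using \<open>i \<le> k\<close>
proof (induction i)
  case (Suc i)
  have le: "run_start x (Suc i) \<le> W"
    using run_start_mono[OF Suc.prems] fit by simp
  show ?case
  proof (rule run_start_Suc_eqI)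
    show "run_start x' i = run_start x i" using Suc by simp
    show "run_start x i < run_start x (Suc i)" by (rule run_start_Suc[OF nec])
    then show "x' (run_start x (Suc i)) \<noteq> x' (run_start x i)"
      using run_start_Suc(2)[OF nec, of i] le agree by (metis dual_order.trans less_imp_le)
    show "x' j = x' (run_start x i)" if "run_start x i \<le> j" "j < run_start x (Suc i)" for j
      using run_start_Suc(3)[OF nec that] le that agree by (metis dual_order.trans less_imp_le)
  qed
qed simp

lemma block_rle_cong:
  assumes nec': "\<not> eventually_constant x'"
    and agree: "\<And>j. j \<le> W \<Longrightarrow> x j = x' j" and fit: "run_start x k \<le> W"
  shows "block (rle x') 0 k = block (rle x) 0 k"
proof -
  note cong = run_start_cong[OF assms]
  have "rle x' j = rle x j" if "j < k" for j
    using cong[of j] cong[of "Suc j"] agree[of "run_start x j"] run_start_mono[of j k] fit that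
    by (simp add: rle_def)
  then show ?thesis
    by (simp add: block_eq_iff)
qed

text \<open>The hypothesis limits every run starting by \<open>k * r\<close> to length
  \<open>r\<close>. The induction keeps the run starts in the range where it applies.\<close>

lemma run_start_le_if_short_runs:
  assumes "\<And>s. s \<le> k * r \<Longrightarrow> \<exists>j<r. x (s + Suc j) \<noteq> x s"
  shows "run_start x k \<le> k * r"
proof -
  have "run_start x i \<le> i * r" if "i \<le> k" for i
    using that
  proof (induction i)
    case (Suc i)
    then have le: "run_start x i \<le> i * r" by simp
    moreover have "i * r \<le> k * r" using Suc.prems by simp
    ultimately obtain j where j: "j < r" "x (run_start x i + Suc j) \<noteq> x (run_start x i)"
      using assms[of "run_start x i"] by (meson order.trans)
    have "run_start x (Suc i) \<le> run_start x i + Suc j"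
      using run_start_Suc(3)[OF nec, of i "run_start x i + Suc j"] j(2) by (metis le_add1 not_le)
    with j le show ?case by (simp)
  qed simp
  then show ?thesis by simp
qed

end

section \<open>Longest common substrings\<close>

lemma common_lengths_finite:
  "finite {k. \<exists>i j. i + k \<le> n \<and> j + k \<le> n \<and> block u i k = block v j k}"
  by (rule finite_subset[of _ "{..n}"]) auto

lemma longest_common_geI:
  assumes "i + k \<le> n" "j + k \<le> n" "block u i k = block v j k"
  shows "k \<le> longest_common n u v"
  unfolding longest_common_def by (rule Max_ge[OF common_lengths_finite]) (use assms in auto)

lemma longest_common_geE:
  assumes "k \<le> longest_common n u v"
  obtains i j where "i + k \<le> n" "j + k \<le> n" "block u i k = block v j k"
proof -
  let ?K = "{k. \<exists>i j. i + k \<le> n \<and> j + k \<le> n \<and> block u i k = block v j k}"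
  have "0 \<in> ?K" by (auto simp: block_def)
  then have "longest_common n u v \<in> ?K"
    unfolding longest_common_def by (intro Max_in common_lengths_finite) blast
  then obtain i j where "i + longest_common n u v \<le> n" "j + longest_common n u v \<le> n"
    "block u i (longest_common n u v) = block v j (longest_common n u v)"
    by blast
  with assms show thesis
    by (intro that[of i j]) (auto simp: block_eq_iff)
qed

lemma longest_common_mono: "n \<le> n' \<Longrightarrow> longest_common n u v \<le> longest_common n' u v"
  by (rule longest_common_geE[OF order_refl, of n u v]) (meson longest_common_geI order.trans)

section \<open>Window events\<close>

text \<open>The detour through another sequence \<open>x'\<close> makes the event depend exactly, and not only up to
  a null set, on the coordinates in \<open>[s, s + W]\<close>.\<close>

definition window_event :: "nat \<Rightarrow> nat \<Rightarrow> ('a \<times> nat) list \<Rightarrow> (nat \<Rightarrow> 'a) set" where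
  "window_event W s w = {x. \<exists>x'. \<not> eventually_constant x' \<and> (\<forall>j\<le>W. x (s + j) = x' j) \<and>
     run_start x' (length w) \<le> W \<and> block (rle x') 0 (length w) = w}"

text \<open>Away from eventually constant sequences the shifted \<open>x\<close> can itself serve as
  witness, and the first runs are the same for every other witness by congruence.\<close>

lemma window_event_iff:
  assumes "\<not> eventually_constant x"
  shows "x \<in> window_event W s w \<longleftrightarrow>
    run_start (shift s x) (length w) \<le> W \<and> block (rle (shift s x)) 0 (length w) = w"
    (is "_ \<longleftrightarrow> ?R")
proof
  assume "x \<in> window_event W s w"
  then obtain x' where x': "\<not> eventually_constant x'" "\<And>j. j \<le> W \<Longrightarrow> x' j = shift s x j"
    "run_start x' (length w) \<le> W" "block (rle x') 0 (length w) = w"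
    by (auto simp: window_event_def shift_def)
  then show ?R
    using run_start_cong[OF x'(1) _ x'(2,3) order_refl] block_rle_cong[OF x'(1) _ x'(2,3)] assms by simp
next
  assume ?R
  then show "x \<in> window_event W s w"
    unfolding window_event_def using assms
    by (auto intro!: exI[of _ "shift s x"] simp: shift_def[of s x, THEN fun_cong])
qed

text \<open>Both witnesses agree with \<open>x\<close> on the whole window and the runs of one of
  them fit into it, so they share their first runs. Disjointness thus holds everywhere, not only
  almost everywhere.\<close>

lemma window_event_disjoint:
  assumes "length w = length w'" "w \<noteq> w'"
  shows "window_event W s w \<inter> window_event W s w' = {}"
proof -
  have "w = w'" if x: "x \<in> window_event W s w" "x \<in> window_event W s w'" for x
  proof -
    obtain x1 where x1: "\<not> eventually_constant x1" "\<And>j. j \<le> W \<Longrightarrow> x (s + j) = x1 j"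
      "run_start x1 (length w) \<le> W" "block (rle x1) 0 (length w) = w"
      using x(1) unfolding window_event_def by blast
    obtain x2 where x2: "\<not> eventually_constant x2" "\<And>j. j \<le> W \<Longrightarrow> x (s + j) = x2 j"
      "block (rle x2) 0 (length w) = w'"
      using x(2) unfolding window_event_def assms(1) by blast
    show "w = w'"
      using block_rle_cong[OF x1(1) x2(1) _ x1(3)] x1(2,4) x2(2,3) by metis
  qed
  with assms(2) show ?thesis by blast
qed

lemma window_event_vimage: "window_event W s w = shift s -` window_event W 0 w"
  by (auto simp: window_event_def shift_def)

text \<open>One run is lost because the windows may start in the interior of a run.\<close>

lemma longest_common_rle_ge_of_window:
  assumes nec: "\<not> eventually_constant x" "\<not> eventually_constant y"
    and ev: "x \<in> window_event W s w" "y \<in> window_event W t w"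
    and le: "s + length w \<le> n" "t + length w \<le> n"
  shows "length w - 1 \<le> longest_common_rle n x y"
proof -
  obtain i where i: "i \<le> s" "\<And>j. rle (shift s x) (Suc j) = rle x (i + Suc j)"
    using rle_shift_Suc[OF nec(1)] by blast
  obtain i' where i': "i' \<le> t" "\<And>j. rle (shift t y) (Suc j) = rle y (i' + Suc j)"
    using rle_shift_Suc[OF nec(2)] by blast
  have eq: "\<forall>l<length w. rle (shift s x) l = rle (shift t y) l"
    using ev by (simp add: window_event_iff nec flip: block_eq_iff[of _ 0 _ _ 0, simplified])
  have "rle x (Suc i + l) = rle y (Suc i' + l)" if "l < length w - 1" for l
    using eq[rule_format, of "Suc l"] i(2)[of l] i'(2)[of l] that by simp
  then have blk: "block (rle x) (Suc i) (length w - 1) = block (rle y) (Suc i') (length w - 1)"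
    by (simp add: block_eq_iff)
  show ?thesis
  proof (cases "length w = 0")
    case False
    then have "Suc i + (length w - 1) \<le> n" "Suc i' + (length w - 1) \<le> n"
      using i(1) i'(1) le by linarith+
    with blk show ?thesis
      unfolding longest_common_rle_def by (intro longest_common_geI)
  qed simp
qed

text \<open>The sum is the decoded length of \<open>w\<close>. Bounding it leaves finitely many
  words of length \<open>k\<close>, although the alphabet of the encoding is infinite.\<close>

definition short_words :: "nat \<Rightarrow> nat \<Rightarrow> ('a \<times> nat) list set" where
  "short_words k W = {w. length w = k \<and> set w \<subseteq> rle_alphabet \<and> sum_list (map snd w) \<le> W}"

lemma finite_short_words: "finite (short_words k W :: ('a::finite \<times> nat) list set)"
proof (rule finite_subset)
  show "short_words k W \<subseteq> {w :: ('a \<times> nat) list. set w \<subseteq> UNIV \<times> {..W} \<and> length w = k}"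
  proof safe
    fix w :: "('a \<times> nat) list" and a l
    assume "w \<in> short_words k W" "(a, l) \<in> set w"
    then show "l \<le> W"
      using member_le_sum_list[of l "map snd w"] by (force simp: short_words_def)
  qed (auto simp: short_words_def)
  show "finite {w :: ('a \<times> nat) list. set w \<subseteq> UNIV \<times> {..W} \<and> length w = k}"
    by (intro finite_lists_length_eq finite_cartesian_product) auto
qed

lemma block_rle_in_short_words_iff:
  assumes "\<not> eventually_constant x"
  shows "block (rle x) 0 k \<in> short_words k W \<longleftrightarrow> run_start x k \<le> W"
  using sum_list_block_rle[OF assms, of 0 k] block_rle_subset[OF assms, of 0 k]
  by (simp add: short_words_def)

text \<open>The windows are placed at the run boundaries where the common block begins, so no run is
  lost. The decoded length of the block is at most \<open>run_start x n\<close>, which yields both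
  the fit and the shortness.\<close>

lemma window_of_longest_common_rle:
  assumes nec: "\<not> eventually_constant x" "\<not> eventually_constant y"
    and fit: "run_start x n \<le> W" "run_start y n \<le> W" and k: "k \<le> longest_common_rle n x y"
  obtains s t w where "s \<le> W" "t \<le> W" "w \<in> short_words k W"
    "x \<in> window_event W s w" "y \<in> window_event W t w"
proof -
  obtain i j where ij: "i + k \<le> n" "j + k \<le> n" "block (rle x) i k = block (rle y) j k"
    using k unfolding longest_common_rle_def by (elim longest_common_geE)
  have *: "run_start z i \<le> W \<and> run_start (shift (run_start z i) z) k \<le> W \<and>
      block (rle (shift (run_start z i) z)) 0 k = block (rle z) i k"
    if z: "\<not> eventually_constant z" "run_start z n \<le> W" "i + k \<le> n" for z :: "nat \<Rightarrow> 'a" and i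
  proof -
    have eq: "block (rle (shift (run_start z i) z)) 0 k = block (rle z) i k"
      by (simp add: block_eq_iff rle_shift_run_start[OF z(1)])
    have "run_start (shift (run_start z i) z) k = sum_list (map snd (block (rle z) i k))"
      using sum_list_block_rle[of "shift (run_start z i) z" 0 k] z(1) by (simp add: eq)
    also have "\<dots> \<le> run_start z (i + k)"
      by (simp add: sum_list_block_rle[OF z(1)])
    finally show ?thesis
      using eq run_start_mono[OF z(1,3)] run_start_mono[OF z(1), of i n] z by simp
  qed
  show thesis
  proof (rule that[of "run_start x i" "run_start y j" "block (rle x) i k"])
    show "run_start x i \<le> W" "run_start y j \<le> W"
      using *[OF nec(1) fit(1) ij(1)] *[OF nec(2) fit(2) ij(2)] by auto
    show "x \<in> window_event W (run_start x i) (block (rle x) i k)"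
      "y \<in> window_event W (run_start y j) (block (rle x) i k)"
      using *[OF nec(1) fit(1) ij(1)] *[OF nec(2) fit(2) ij(2)] ij(3)
      by (auto simp: window_event_iff nec)
    show "block (rle x) i k \<in> short_words k W"
      using block_rle_in_short_words_iff[of "shift (run_start x i) x" k W] nec(1)
        *[OF nec(1) fit(1) ij(1)] by simp
  qed
qed

section \<open>A second moment bound for coincidences in a product space\<close>

text \<open>Chebyshev's argument for the number \<open>S\<close> of events that occur: where none
  occurs, \<open>S\<close> vanishes and its squared deviation from the mean equals the squared
  mean.\<close>

lemma (in prob_space) prob_avoid_le_variance:
  assumes fin: "finite I" and ev: "\<And>t. t \<in> I \<Longrightarrow> E t \<in> events"
  shows "prob (space M - (\<Union>t\<in>I. E t)) * (\<Sum>t\<in>I. prob (E t))\<^sup>2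
    \<le> (\<Sum>t\<in>I. \<Sum>t'\<in>I. prob (E t \<inter> E t')) - (\<Sum>t\<in>I. prob (E t))\<^sup>2"
proof -
  define S :: "'a \<Rightarrow> real" where "S x = (\<Sum>t\<in>I. indicator (E t) x)" for x
  define e where "e = (\<Sum>t\<in>I. prob (E t))"
  let ?N = "space M - (\<Union>t\<in>I. E t)"
  have N: "?N \<in> events" using fin ev by auto
  have int1: "integrable M (indicator (E t) :: 'a \<Rightarrow> real)" if "t \<in> I" for t
    using ev[OF that] by (simp add: emeasure_eq_measure)
  have int2: "integrable M (indicator (E t \<inter> E t') :: 'a \<Rightarrow> real)" if "t \<in> I" "t' \<in> I" for t t'
    using ev that by (simp add: emeasure_eq_measure sets.Int)
  have S2: "(S x)\<^sup>2 = (\<Sum>t\<in>I. \<Sum>t'\<in>I. indicator (E t \<inter> E t') x)" for x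
    by (simp add: S_def power2_eq_square sum_product indicator_inter_arith)
  have iS: "integrable M S" "integrable M (\<lambda>x. (S x)\<^sup>2)"
    unfolding S2 unfolding S_def using int1 int2 by (auto intro!: Bochner_Integration.integrable_sum)
  have ES: "expectation S = e"
    unfolding S_def e_def using int1 ev
    by (subst Bochner_Integration.integral_sum) (auto intro!: sum.cong simp: sets.Int_space_eq2)
  have ES2: "expectation (\<lambda>x. (S x)\<^sup>2) = (\<Sum>t\<in>I. \<Sum>t'\<in>I. prob (E t \<inter> E t'))"
    unfolding S2 using int2 ev
    by (subst Bochner_Integration.integral_sum)
      (auto intro!: sum.cong Bochner_Integration.integrable_sum simp: Bochner_Integration.integral_sum sets.Int sets.Int_space_eq2)
  have "prob ?N * e\<^sup>2 = expectation (\<lambda>x. indicator ?N x * e\<^sup>2)"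
    using N by (simp add: sets.Int_space_eq2)
  also have "\<dots> \<le> expectation (\<lambda>x. (S x)\<^sup>2 - 2 * e * S x + e\<^sup>2)"
  proof (rule integral_mono)
    show "integrable M (\<lambda>x. indicator ?N x * e\<^sup>2)"
      using N by (intro integrable_mult_left) (simp add: emeasure_eq_measure)
    show "integrable M (\<lambda>x. (S x)\<^sup>2 - 2 * e * S x + e\<^sup>2)"
      using iS by auto
    fix x
    have "indicator ?N x * e\<^sup>2 \<le> (S x - e)\<^sup>2"
      by (cases "x \<in> ?N") (auto simp: S_def)
    then show "indicator ?N x * e\<^sup>2 \<le> (S x)\<^sup>2 - 2 * e * S x + e\<^sup>2"
      by (simp add: power2_diff algebra_simps)
  qed
  also have "\<dots> = (\<Sum>t\<in>I. \<Sum>t'\<in>I. prob (E t \<inter> E t')) - e\<^sup>2"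
    using iS by (simp add: ES ES2 prob_space) (simp add: power2_eq_square)
  finally show ?thesis unfolding e_def .
qed

text \<open>Second moment method for the number of coincidences \<open>(i, j, w)\<close>, whose mean
  is m^2 Z. Pairs of coincidences are sorted by whether \<open>i = i'\<close> and whether
  \<open>j = j'\<close>: among the m^4 index quadruples, about 2 m^3 satisfy exactly one equality
  and m^2 satisfy both.\<close>

lemma (in prob_space) prob_no_coincidence_le:
  fixes A :: "nat \<Rightarrow> 'w \<Rightarrow> 'a set" and p :: "'w \<Rightarrow> real"
  assumes fin: "finite \<Omega>" and m: "m > 0"
    and ev: "\<And>i w. i < m \<Longrightarrow> w \<in> \<Omega> \<Longrightarrow> A i w \<in> events"
    and prob_A: "\<And>i w. i < m \<Longrightarrow> w \<in> \<Omega> \<Longrightarrow> prob (A i w) = p w"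
    and disj: "\<And>i w w'. i < m \<Longrightarrow> w \<in> \<Omega> \<Longrightarrow> w' \<in> \<Omega> \<Longrightarrow> w \<noteq> w' \<Longrightarrow> A i w \<inter> A i w' = {}"
    and mix: "\<And>i j w w'. i < j \<Longrightarrow> j < m \<Longrightarrow> w \<in> \<Omega> \<Longrightarrow> w' \<in> \<Omega> \<Longrightarrow>
      prob (A i w \<inter> A j w') \<le> (1 + \<theta>) * (p w * p w') + \<eta>"
    and th: "0 \<le> \<theta>" "\<theta> \<le> 1" and eta: "0 \<le> \<eta>"
    and Z: "Z = (\<Sum>w\<in>\<Omega>. (p w)\<^sup>2)" "Z > 0"
  shows "measure (M \<Otimes>\<^sub>M M) (space (M \<Otimes>\<^sub>M M) - (\<Union>i<m. \<Union>j<m. \<Union>w\<in>\<Omega>. A i w \<times> A j w))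
    \<le> 3 * \<theta> + 5 * \<eta> / Z\<^sup>2 + 4 / (real m * sqrt Z) + 1 / (real m * sqrt Z)\<^sup>2"
proof -
  interpret P: pair_prob_space M M ..
  define q where "q i i' w w' = prob (A i w \<inter> A i' w')" for i i' w w'
  have q_nn: "0 \<le> q i i' w w'" for i i' w w' by (simp add: q_def)
  have p_nn: "0 \<le> p w" if "w \<in> \<Omega>" for w using prob_A[OF m that] by (metis measure_nonneg)
  have q_le: "q i i' w w' \<le> (1 + \<theta>) * (p w * p w') + \<eta>"
    if "i < m" "i' < m" "i \<noteq> i'" "w \<in> \<Omega>" "w' \<in> \<Omega>" for i i' w w'
    using mix[of i i' w w'] mix[of i' i w' w] that unfolding q_def
    by (cases "i < i'") (auto simp: Int_commute mult.commute)
  have q_eq: "q i i w w' = (if w = w' then p w else 0)" if "i < m" "w \<in> \<Omega>" "w' \<in> \<Omega>" for i w w'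
    using prob_A disj that by (auto simp: q_def)
  have sum_q: "(\<Sum>w'\<in>\<Omega>. q i i' w w') \<le> p w" if "i < m" "i' < m" "w \<in> \<Omega>" for i i' w
  proof -
    have "(\<Sum>w'\<in>\<Omega>. q i i' w w') = prob (\<Union>w'\<in>\<Omega>. A i w \<inter> A i' w')"
      unfolding q_def
    proof (rule finite_measure_finite_Union[symmetric, OF fin])
      show "(\<lambda>w'. A i w \<inter> A i' w') ` \<Omega> \<subseteq> events"
        using that ev by auto
      show "disjoint_family_on (\<lambda>w'. A i w \<inter> A i' w') \<Omega>"
        unfolding disjoint_family_on_def using disj[OF that(2)] by blast
    qed
    also have "\<dots> \<le> prob (A i w)"
      using that ev fin by (intro finite_measure_mono) auto
    finally show ?thesis using prob_A that by simp
  qed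
  have sum_p: "(\<Sum>w\<in>\<Omega>. p w) \<le> 1"
  proof -
    have "(\<Sum>w\<in>\<Omega>. p w) = prob (\<Union>w\<in>\<Omega>. A 0 w)"
      using ev disj fin m by (subst finite_measure_finite_Union) (auto simp: disjoint_family_on_def prob_A)
    then show ?thesis by simp
  qed
  have sum_qq: "(\<Sum>w\<in>\<Omega>. \<Sum>w'\<in>\<Omega>. q i i' w w') \<le> 1" if "i < m" "i' < m" for i i'
    using sum_mono[of \<Omega> "\<lambda>w. \<Sum>w'\<in>\<Omega>. q i i' w w'" p] sum_q that sum_p by fastforce
  have sum_pp: "(\<Sum>w\<in>\<Omega>. \<Sum>w'\<in>\<Omega>. p w * p w') \<le> 1"
    using sum_p sum_nonneg[of \<Omega> p] p_nn
    by (simp flip: sum_product) (simp add: mult_le_one)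
  have sum_ppp: "(\<Sum>w\<in>\<Omega>. \<Sum>w'\<in>\<Omega>. (p w * p w')\<^sup>2) = Z\<^sup>2"
    unfolding Z(1) power2_eq_square[of "sum _ _"] sum_product by (simp add: power_mult_distrib)
  define a where "a = (1 + 3 * \<theta>) * Z\<^sup>2 + 3 * \<eta>"
  define b where "b = 2 * (Z * sqrt Z) + \<eta>"
  define T where "T i i' j j' = (\<Sum>w\<in>\<Omega>. \<Sum>w'\<in>\<Omega>. q i i' w w' * q j j' w w')" for i i' j j'
  \<comment> \<open>The two factors are replaced by the mixing bound one after the other. Each time
    \<eta> multiplies a sum of probabilities that is at most 1, so the number of words does not
    enter. The constants come from (1 + \<theta>)^2 \<le> 1 + 3 \<theta> and 2 + \<theta> \<le>
    3.\<close>
  have T_off: "T i i' j j' \<le> a" if ij: "i < m" "i' < m" "j < m" "j' < m" "i \<noteq> i'" "j \<noteq> j'" for i i' j j'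
  proof -
    let ?Q = "\<Sum>w\<in>\<Omega>. \<Sum>w'\<in>\<Omega>. q i i' w w' * (p w * p w')"
    have "?Q \<le> (\<Sum>w\<in>\<Omega>. \<Sum>w'\<in>\<Omega>. ((1 + \<theta>) * (p w * p w') + \<eta>) * (p w * p w'))"
      using q_le ij p_nn by (intro sum_mono mult_right_mono) auto
    also have "\<dots> = (1 + \<theta>) * Z\<^sup>2 + \<eta> * (\<Sum>w\<in>\<Omega>. \<Sum>w'\<in>\<Omega>. p w * p w')"
      unfolding sum_ppp[symmetric]
      by (simp add: sum_distrib_left sum.distrib algebra_simps power2_eq_square)
    also have "\<dots> \<le> (1 + \<theta>) * Z\<^sup>2 + \<eta>"
      using mult_left_mono[OF sum_pp eta] by simp
    finally have Q: "?Q \<le> (1 + \<theta>) * Z\<^sup>2 + \<eta>" .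
    have "T i i' j j' \<le> (\<Sum>w\<in>\<Omega>. \<Sum>w'\<in>\<Omega>. q i i' w w' * ((1 + \<theta>) * (p w * p w') + \<eta>))"
      unfolding T_def using q_le ij q_nn by (intro sum_mono mult_left_mono) auto
    also have "\<dots> = (1 + \<theta>) * ?Q + \<eta> * (\<Sum>w\<in>\<Omega>. \<Sum>w'\<in>\<Omega>. q i i' w w')"
      by (simp add: sum_distrib_left sum.distrib algebra_simps)
    also have "\<dots> \<le> (1 + \<theta>) * ((1 + \<theta>) * Z\<^sup>2 + \<eta>) + \<eta> * 1"
      using th eta sum_qq[OF ij(1,2)] Q by (intro add_mono mult_left_mono) auto
    also have "\<dots> = (1 + 2 * \<theta> + \<theta> * \<theta>) * Z\<^sup>2 + (2 + \<theta>) * \<eta>"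
      by (simp add: algebra_simps)
    also have "\<dots> \<le> a"
    proof -
      have "1 + 2 * \<theta> + \<theta> * \<theta> \<le> 1 + 3 * \<theta>"
        using mult_left_mono[OF th(2,1)] by simp
      from mult_right_mono[OF this, of "Z\<^sup>2"] mult_right_mono[of "2 + \<theta>" 3 \<eta>] show ?thesis
        unfolding a_def using th eta by simp
    qed
    finally show ?thesis .
  qed
  have p_le: "p w \<le> sqrt Z" if "w \<in> \<Omega>" for w
    unfolding Z(1) using that fin by (intro real_le_rsqrt member_le_sum) auto
  \<comment> \<open>If one pair of indices agrees, disjointness forces \<open>w = w'\<close> and
    that factor becomes \<open>p w\<close>. The main part is then cubic in \<open>p\<close>;
    estimating one \<open>p w\<close> by \<open>sqrt Z\<close> leaves
    \<open>Z * sqrt Z\<close>.\<close>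
  have T_diag: "(\<Sum>w\<in>\<Omega>. p w * q j j' w w) \<le> b" if ij: "j < m" "j' < m" "j \<noteq> j'" for j j'
  proof -
    have "(\<Sum>w\<in>\<Omega>. p w * q j j' w w) \<le> (\<Sum>w\<in>\<Omega>. p w * (2 * (sqrt Z * p w) + \<eta>))"
    proof (intro sum_mono mult_left_mono p_nn)
      fix w assume w: "w \<in> \<Omega>"
      have "(1 + \<theta>) * (p w * p w) \<le> 2 * (sqrt Z * p w)"
        using th Z(2) p_le[OF w] p_nn[OF w] by (intro mult_mono) auto
      then show "q j j' w w \<le> 2 * (sqrt Z * p w) + \<eta>"
        using q_le[OF ij w w] by simp
    qed
    also have "\<dots> = 2 * (Z * sqrt Z) + \<eta> * (\<Sum>w\<in>\<Omega>. p w)"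
      unfolding Z(1) by (simp add: sum_distrib_left sum.distrib algebra_simps power2_eq_square sum_distrib_right)
    also have "\<dots> \<le> b"
      unfolding b_def using mult_left_mono[OF sum_p eta] by simp
    finally show ?thesis .
  qed
  have ab: "0 \<le> a" "0 \<le> b" using th eta Z(2) by (auto simp: a_def b_def)
  \<comment> \<open>The cases are merged into a sum of indicators with nonnegative coefficients, so
    that summing over all indices reduces to counting.\<close>
  have T_le: "T i i' j j' \<le> a + (if i = i' then b else 0) + (if j = j' then b else 0)
      + (if i = i' \<and> j = j' then Z else 0)" if "i < m" "i' < m" "j < m" "j' < m" for i i' j j'
  proof -
    consider "i = i'" "j = j'" | "i = i'" "j \<noteq> j'" | "i \<noteq> i'" "j = j'" | "i \<noteq> i'" "j \<noteq> j'" by blast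
    then show ?thesis
    proof cases
      case 1
      have "T i i' j j' = Z"
        unfolding T_def Z(1) using 1 that fin by (simp add: q_eq if_distrib if_distribR power2_eq_square sum.delta cong: if_cong)
      with 1 ab show ?thesis by simp
    next
      case 2
      have "T i i' j j' = (\<Sum>w\<in>\<Omega>. p w * q j j' w w)"
        unfolding T_def using 2 that fin by (simp add: q_eq if_distrib if_distribR sum.delta cong: if_cong)
      with 2 ab T_diag[of j j'] that show ?thesis by simp
    next
      case 3
      have "T i i' j j' = (\<Sum>w\<in>\<Omega>. p w * q i i' w w)"
        unfolding T_def using 3 that fin
        by (simp add: q_eq if_distrib if_distribR sum.delta mult.commute cong: if_cong)
      with 3 ab T_diag[of i i'] that show ?thesis by simp
    next
      case 4
      then show ?thesis using T_off[of i i' j j'] that by simp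
    qed
  qed
  define J where "J = {..<m} \<times> {..<m}"
  define E where "E t = (case t of ((i, j), w) \<Rightarrow> A i w \<times> A j w)" for t
  have finJ: "finite (J \<times> \<Omega>)" using fin by (simp add: J_def)
  have evE: "E t \<in> sets (M \<Otimes>\<^sub>M M)" if "t \<in> J \<times> \<Omega>" for t
    using that ev by (auto simp: E_def J_def)
  have times: "measure (M \<Otimes>\<^sub>M M) (B \<times> C) = prob B * prob C" if "B \<in> events" "C \<in> events" for B C
    using that by (simp add: measure_def emeasure_pair_measure_Times enn2real_mult)
  have cp: "(\<Sum>t\<in>J \<times> \<Omega>. g t) = (\<Sum>ij\<in>J. \<Sum>w\<in>\<Omega>. g (ij, w))" for g :: "_ \<Rightarrow> real"
    by (simp add: sum.cartesian_product)
  have mean: "(\<Sum>t\<in>J \<times> \<Omega>. measure (M \<Otimes>\<^sub>M M) (E t)) = (real m)\<^sup>2 * Z"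
  proof -
    have "(\<Sum>t\<in>J \<times> \<Omega>. measure (M \<Otimes>\<^sub>M M) (E t)) = (\<Sum>ij\<in>J. \<Sum>w\<in>\<Omega>. measure (M \<Otimes>\<^sub>M M) (E (ij, w)))"
      by (rule cp)
    also have "\<dots> = (\<Sum>ij\<in>J. Z)"
      unfolding Z(1) using ev prob_A
      by (intro sum.cong) (auto simp: J_def E_def times power2_eq_square)
    also have "\<dots> = (real m)\<^sup>2 * Z" by (simp add: J_def power2_eq_square)
    finally show ?thesis .
  qed
  have second: "(\<Sum>t\<in>J \<times> \<Omega>. \<Sum>t'\<in>J \<times> \<Omega>. measure (M \<Otimes>\<^sub>M M) (E t \<inter> E t'))
      \<le> (real m)^4 * a + 2 * (real m)^3 * b + (real m)\<^sup>2 * Z"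
  proof -
    have "(\<Sum>t\<in>J \<times> \<Omega>. \<Sum>t'\<in>J \<times> \<Omega>. measure (M \<Otimes>\<^sub>M M) (E t \<inter> E t')) =
      (\<Sum>ij\<in>J. \<Sum>w\<in>\<Omega>. \<Sum>ij'\<in>J. \<Sum>w'\<in>\<Omega>. measure (M \<Otimes>\<^sub>M M) (E (ij, w) \<inter> E (ij', w')))"
      by (simp only: cp)
    also have "\<dots> = (\<Sum>ij\<in>J. \<Sum>ij'\<in>J. \<Sum>w\<in>\<Omega>. \<Sum>w'\<in>\<Omega>. measure (M \<Otimes>\<^sub>M M) (E (ij, w) \<inter> E (ij', w')))"
      by (rule sum.cong[OF refl], rule sum.swap)
    also have "\<dots> = (\<Sum>ij\<in>J. \<Sum>ij'\<in>J. T (fst ij) (fst ij') (snd ij) (snd ij'))"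
      unfolding T_def q_def using ev
      by (intro sum.cong refl) (auto simp: J_def E_def Times_Int_Times times sets.Int)
    also have "\<dots> \<le> (\<Sum>ij\<in>J. \<Sum>ij'\<in>J. a + (if fst ij = fst ij' then b else 0)
        + (if snd ij = snd ij' then b else 0) + (if fst ij = fst ij' \<and> snd ij = snd ij' then Z else 0))"
      by (intro sum_mono T_le) (auto simp: J_def)
    also have "\<dots> = (\<Sum>ij\<in>J. (real m)\<^sup>2 * a + real m * b + real m * b + Z)"
    proof (rule sum.cong[OF refl])
      fix ij assume ij: "ij \<in> J"
      have 1: "(\<Sum>ij'\<in>J. if fst ij = fst ij' then b else 0) = real m * b"
        using ij unfolding J_def sum.cartesian_product'[of "\<lambda>ij'. if fst ij = fst ij' then b else 0"]
        by (subst sum.swap) (auto simp: sum.delta')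
      have 2: "(\<Sum>ij'\<in>J. if snd ij = snd ij' then b else 0) = real m * b"
        using ij unfolding J_def sum.cartesian_product'[of "\<lambda>ij'. if snd ij = snd ij' then b else 0"]
        by (auto simp: sum.delta')
      have 3: "(\<Sum>ij'\<in>J. if fst ij = fst ij' \<and> snd ij = snd ij' then Z else 0) = Z"
        using ij by (simp add: prod_eq_iff[symmetric] J_def)
      have 4: "(\<Sum>ij'\<in>J. a) = (real m)\<^sup>2 * a"
        by (simp add: J_def power2_eq_square)
      show "(\<Sum>ij'\<in>J. a + (if fst ij = fst ij' then b else 0)
        + (if snd ij = snd ij' then b else 0) + (if fst ij = fst ij' \<and> snd ij = snd ij' then Z else 0))
        = (real m)\<^sup>2 * a + real m * b + real m * b + Z"
        by (simp only: sum.distrib 1 2 3 4)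
    qed
    also have "\<dots> = (real m)^4 * a + 2 * (real m)^3 * b + (real m)\<^sup>2 * Z"
      by (simp add: J_def power2_eq_square power3_eq_cube power4_eq_xxxx algebra_simps)
    finally show ?thesis .
  qed
  let ?N = "space (M \<Otimes>\<^sub>M M) - (\<Union>t\<in>J \<times> \<Omega>. E t)"
  have N: "space (M \<Otimes>\<^sub>M M) - (\<Union>i<m. \<Union>j<m. \<Union>w\<in>\<Omega>. A i w \<times> A j w) = ?N"
    by (auto simp: J_def E_def)
  have "measure (M \<Otimes>\<^sub>M M) ?N * ((real m)\<^sup>2 * Z)\<^sup>2
      \<le> (real m)^4 * a + 2 * (real m)^3 * b + (real m)\<^sup>2 * Z - ((real m)\<^sup>2 * Z)\<^sup>2"
    using P.prob_avoid_le_variance[of "J \<times> \<Omega>" E, OF finJ evE] second unfolding mean by linarith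
  then have "measure (M \<Otimes>\<^sub>M M) ?N
      \<le> ((real m)^4 * a + 2 * (real m)^3 * b + (real m)\<^sup>2 * Z - ((real m)\<^sup>2 * Z)\<^sup>2) / ((real m)\<^sup>2 * Z)\<^sup>2"
    using m Z(2) by (subst pos_le_divide_eq) auto
  \<comment> \<open>The leading 1 in \<open>a\<close> cancels against the squared mean. Of
    \<open>b\<close>, the main part gives the term with constant 4 and the error part gives 2 / m;
    the full diagonal gives the last term.\<close>
  also have "\<dots> = 3 * \<theta> + (3 + 2 / real m) * \<eta> / Z\<^sup>2 + 4 / (real m * sqrt Z) + 1 / (real m * sqrt Z)\<^sup>2"
  proof -
    define y where "y = sqrt Z"
    have y: "Z = y\<^sup>2" "sqrt Z = y" "y > 0" using Z(2) by (auto simp: y_def)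
    show ?thesis
      unfolding a_def b_def y(2) unfolding y(1) using m y(3)
      by (simp add: field_simps power2_eq_square power3_eq_cube power4_eq_xxxx)
  qed
  also have "\<dots> \<le> 3 * \<theta> + 5 * \<eta> / Z\<^sup>2 + 4 / (real m * sqrt Z) + 1 / (real m * sqrt Z)\<^sup>2"
  proof -
    have "2 / real m \<le> 2" using m by (simp add: field_simps)
    then show ?thesis
      using eta by (intro add_right_mono add_left_mono divide_right_mono mult_right_mono) auto
  qed
  finally show ?thesis unfolding N .
qed

section \<open>Stationary sources with exponentially unlikely long runs\<close>

lemma coord_sigma_mono:
  assumes "J' \<le> J" "L \<le> L'"
  shows "coord_sigma J L \<subseteq> coord_sigma J' L'"
  unfolding coord_sigma_def using assms by (intro sigma_sets_mono') (auto intro: order.trans)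

lemma sigma_algebra_coord_sigma: "sigma_algebra UNIV (coord_sigma J L)"
  unfolding coord_sigma_def by (rule sigma_algebra_sigma_sets) simp

text \<open>Over a finite alphabet only finitely many patterns of length \<open>W + 1\<close> occur,
  so the set is a finite union of cylinders, whatever the predicate \<open>Q\<close>.\<close>

lemma coord_sigma_window:
  "{x :: nat \<Rightarrow> 'a::finite. \<exists>x'. Q x' \<and> (\<forall>j\<le>W. x (s + j) = x' j)} \<in> coord_sigma s (enat (s + W))"
proof -
  interpret sigma_algebra UNIV "coord_sigma s (enat (s + W)) :: (nat \<Rightarrow> 'a) set set"
    by (rule sigma_algebra_coord_sigma)
  define V where "V = {map x' [0..<Suc W] | x'. Q x'}"
  have "finite {v :: 'a list. set v \<subseteq> UNIV \<and> length v = Suc W}"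
    by (intro finite_lists_length_eq) simp
  then have "finite V"
    by (rule rev_finite_subset) (unfold V_def, clarify, simp)
  have 1: "{x. x (s + j) \<in> {b}} \<in> coord_sigma s (enat (s + W))" if "j \<le> W" for j and b :: 'a
    unfolding coord_sigma_def using that
    by (intro sigma_sets.Basic CollectI exI[of _ "s + j"] exI[of _ "{b}"]) simp
  have 2: "(\<Inter>j\<in>{..W}. {x. x (s + j) \<in> {v ! j}}) \<in> coord_sigma s (enat (s + W))" for v :: "'a list"
    by (rule countable_INT'') (use 1 in auto)
  have "(\<Union>v\<in>V. \<Inter>j\<in>{..W}. {x. x (s + j) \<in> {v ! j}}) \<in> coord_sigma s (enat (s + W))"
    by (rule finite_UN[OF \<open>finite V\<close>]) (rule 2)
  also have "(\<Union>v\<in>V. \<Inter>j\<in>{..W}. {x. x (s + j) \<in> {v ! j}}) =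
      {x. \<exists>x'. Q x' \<and> (\<forall>j\<le>W. x (s + j) = x' j)}"
  proof -
    have *: "map x' [0..<Suc W] ! j = x' j" if "j \<le> W" for x' :: "nat \<Rightarrow> 'a" and j
      using that by (simp del: upt_Suc)
    show ?thesis
      unfolding V_def by (auto simp: * simp del: upt_Suc)
  qed
  finally show ?thesis .
qed

lemma window_event_coord_sigma:
  "window_event W s w \<in> coord_sigma s (enat (s + W))" for w :: "('a::finite \<times> nat) list"
proof -
  have "window_event W s w = {x. \<exists>x'. (\<not> eventually_constant x' \<and> run_start x' (length w) \<le> W \<and>
      block (rle x') 0 (length w) = w) \<and> (\<forall>j\<le>W. x (s + j) = x' j)}"
    unfolding window_event_def by blast
  then show ?thesis
    by (simp only: coord_sigma_window)
qed

locale stationary_source =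
  fixes M :: "(nat \<Rightarrow> 'a::finite) measure"
  assumes stationary: "stationary_process M"

sublocale stationary_source \<subseteq> prob_space M
  using stationary by (simp add: stationary_process_def)

context stationary_source
begin

lemma sets_M: "sets M = sets (seq_space :: (nat \<Rightarrow> 'a) measure)"
  using stationary by (simp add: stationary_process_def)

lemma space_M [simp]: "space M = UNIV"
  using sets_eq_imp_space_eq[OF sets_M] by (simp add: seq_space_def space_PiM)

lemma measurable_coord [measurable]: "(\<lambda>x. x k) \<in> measurable M (count_space UNIV)"
  unfolding measurable_cong_sets[OF sets_M refl] seq_space_def by measurable

lemma measurable_shift [measurable]: "shift s \<in> measurable M M"
proof -
  have "shift s \<in> measurable M seq_space"
    unfolding seq_space_def shift_def
    by (intro measurable_PiM_single') (auto simp: space_PiM)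
  then show ?thesis
    using measurable_cong_sets[OF refl sets_M] by blast
qed

lemma distr_shift: "distr M M (shift s) = M"
proof (induction s)
  case 0
  then show ?case by (simp add: shift_def distr_id)
next
  case (Suc s)
  have "distr M M (shift (Suc s)) = distr (distr M M (shift s)) M (shift 1)"
    by (subst distr_distr) (auto intro!: arg_cong[of _ _ "distr M M"] simp: shift_def fun_eq_iff)
  also have "\<dots> = distr M M (shift 1)"
    by (simp only: Suc.IH)
  also have "shift 1 = (\<lambda>(x :: nat \<Rightarrow> 'a) n. x (Suc n))"
    by (simp add: shift_def fun_eq_iff)
  also have "distr M M \<dots> = M"
    using stationary by (simp add: stationary_process_def)
  finally show ?case .
qed

lemma prob_shift_vimage:
  assumes "A \<in> events"
  shows "prob (shift s -` A) = prob A"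
proof -
  have "prob A = measure (distr M M (shift s)) A"
    by (simp only: distr_shift)
  also have "\<dots> = prob (shift s -` A)"
    using assms by (subst measure_distr) auto
  finally show ?thesis ..
qed

lemma coord_sigma_sets: "coord_sigma J L \<subseteq> events"
  unfolding coord_sigma_def
proof (rule sets.sigma_sets_subset[of _ M, simplified])
  show "{{x. x k \<in> S} |k S. J \<le> k \<and> enat k \<le> L} \<subseteq> events"
  proof safe
    fix k :: nat and S :: "'a set"
    have "(\<lambda>x. x k) -` S \<inter> space M \<in> events"
      by (rule measurable_sets[OF measurable_coord]) simp
    then show "{x. x k \<in> S} \<in> events" by (simp add: vimage_def)
  qed
qed

lemma window_event_sets [measurable]: "window_event W s w \<in> events"
  using window_event_coord_sigma coord_sigma_sets by blast

text \<open>The second moment needs joint probabilities bounded from above only. Under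
  \<alpha>-mixing the error is purely additive, under \<psi>-mixing purely multiplicative; the
  common form allows both.\<close>

lemma mixing_upper_bound:
  assumes mixing: "alpha_mixing_exponential M \<or> (\<exists>a :: real. a > 0 \<and> psi_mixing M (\<lambda>g. real g powr (- a)))"
  obtains a C \<kappa> :: real where "a > 0" "C \<ge> 0" "\<kappa> > 0"
    "\<And>n g A B. g \<ge> 1 \<Longrightarrow> A \<in> coord_sigma 0 (enat n) \<Longrightarrow> B \<in> coord_sigma (n + g) \<infinity> \<Longrightarrow>
      prob (A \<inter> B) \<le> (1 + real g powr (- a)) * (prob A * prob B) + C * exp (- \<kappa> * real g)"
  using mixing
proof
  assume "alpha_mixing_exponential M"
  then obtain \<alpha> C \<kappa> where "\<kappa> > 0" and \<alpha>: "alpha_mixing M \<alpha>" "\<And>g. \<alpha> g \<le> C * exp (- \<kappa> * real g)"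
    unfolding alpha_mixing_exponential_def by blast
  show thesis
  \<comment> \<open>The exponent 1 is arbitrary, since its term only adds a nonnegative surplus;
    \<open>max C 0\<close> secures the sign of the constant.\<close>
  proof (rule that[of 1 "max C 0" \<kappa>])
    fix n g :: nat and A B :: "(nat \<Rightarrow> 'a) set"
    assume "A \<in> coord_sigma 0 (enat n)" "B \<in> coord_sigma (n + g) \<infinity>"
    then have "prob (A \<inter> B) - prob A * prob B \<le> \<alpha> g"
      using \<alpha>(1) unfolding alpha_mixing_def by (meson abs_le_D1)
    also have "\<dots> \<le> max C 0 * exp (- \<kappa> * real g)"
      by (rule order.trans[OF \<alpha>(2)], rule mult_right_mono) auto
    finally have "prob (A \<inter> B) \<le> prob A * prob B + max C 0 * exp (- \<kappa> * real g)"
      by simp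
    moreover have "0 \<le> real g powr (- 1) * (prob A * prob B)"
      by (intro mult_nonneg_nonneg) auto
    ultimately show "prob (A \<inter> B) \<le>
        (1 + real g powr (- 1)) * (prob A * prob B) + max C 0 * exp (- \<kappa> * real g)"
      unfolding distrib_right by linarith
  qed (use \<open>\<kappa> > 0\<close> in auto)
next
  assume "\<exists>a :: real. a > 0 \<and> psi_mixing M (\<lambda>g. real g powr (- a))"
  then obtain a :: real where a: "a > 0" "psi_mixing M (\<lambda>g. real g powr (- a))" by blast
  show thesis
  proof (rule that[of a 0 1])
    fix n g :: nat and A B :: "(nat \<Rightarrow> 'a) set"
    assume g: "g \<ge> 1" and AB: "A \<in> coord_sigma 0 (enat n)" "B \<in> coord_sigma (n + g) \<infinity>"
    have AB': "A \<in> events" "B \<in> events"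
      using AB coord_sigma_sets by blast+
    show "prob (A \<inter> B) \<le> (1 + real g powr (- a)) * (prob A * prob B) + 0 * exp (- 1 * real g)"
    \<comment> \<open>\<open>psi_mixing\<close> speaks of events of positive measure only, so null
      events are treated apart.\<close>
    proof (cases "prob A = 0 \<or> prob B = 0")
      case True
      then have "prob (A \<inter> B) = 0"
        using finite_measure_mono[of "A \<inter> B" A] finite_measure_mono[of "A \<inter> B" B] AB'
        by (metis Int_lower1 Int_lower2 measure_le_0_iff)
      then show ?thesis by simp
    next
      case False
      then have pos: "prob A > 0" "prob B > 0" by (auto simp: zero_less_measure_iff)
      then have "(prob (A \<inter> B) - prob A * prob B) / (prob A * prob B) \<le> real g powr (- a)"
        using a(2) g AB unfolding psi_mixing_def by (meson abs_le_D1)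
      then show ?thesis
        using pos by (simp add: divide_le_eq algebra_simps)
    qed
  qed (use a in auto)
qed


end

section \<open>Rarity of long runs\<close>

locale exponential_run_source = stationary_source M for M :: "(nat \<Rightarrow> 'a::finite) measure" +
  fixes c h :: real
  assumes c_pos: "c > 0" and h_pos: "h > 0"
    and runs: "\<And>n a. n \<ge> 1 \<Longrightarrow> word_prob M (replicate n a) \<le> c * exp (- h * real n)"
begin

text \<open>The bound for the probability of a long run; the cardinality comes from a union over the
  repeated letter.\<close>

definition run_tail :: "nat \<Rightarrow> real" where
  "run_tail r = real CARD('a) * c * exp (- h * real r)"

lemma run_tail_nonneg: "0 \<le> run_tail r"
  using c_pos by (simp add: run_tail_def)

text \<open>The position \<open>s\<close> is not tied to a run boundary, so stationarity applies to
  the event.\<close>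

definition long_run :: "nat \<Rightarrow> nat \<Rightarrow> (nat \<Rightarrow> 'a) set" where
  "long_run s r = {x. \<forall>j<r. x (s + Suc j) = x s}"

lemma long_run_sets [measurable]: "long_run s r \<in> events"
proof -
  have "{x \<in> space M. \<forall>j<r. x (s + Suc j) = x s} \<in> events" by measurable
  then show ?thesis by (simp add: long_run_def)
qed

lemma block_eq_sets: "{x. block x 0 k = w} \<in> events"
proof -
  have "{x. block x 0 k = w} = {x \<in> space M. length w = k \<and> (\<forall>j<k. x j = w ! j)}"
    by (simp add: block_eq_word_iff)
  also have "\<dots> \<in> events" by measurable
  finally show ?thesis .
qed

lemma prob_long_run: "prob (long_run s r) \<le> run_tail r"
proof -
  have "long_run s r = shift s -` long_run 0 r"
    by (auto simp: long_run_def shift_def)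
  then have "prob (long_run s r) = prob (long_run 0 r)"
    by (simp add: prob_shift_vimage)
  also have "long_run 0 r = (\<Union>a. {x \<in> space M. block x 0 (Suc r) = replicate (Suc r) a})"
  proof -
    have "block x 0 (Suc r) = replicate (Suc r) a \<longleftrightarrow> (\<forall>j\<le>r. x j = a)" for x :: "nat \<Rightarrow> 'a" and a
      by (simp add: block_eq_word_iff less_Suc_eq_le del: replicate_Suc)
    moreover have "x \<in> long_run 0 r \<longleftrightarrow> (\<forall>j\<le>r. x j = x 0)" for x :: "nat \<Rightarrow> 'a"
    proof
      assume x: "x \<in> long_run 0 r"
      show "\<forall>j\<le>r. x j = x 0"
      proof (intro allI impI)
        fix j assume "j \<le> r"
        with x show "x j = x 0" by (cases j) (auto simp: long_run_def)
      qed
    qed (unfold long_run_def, clarify, metis Suc_leI add_0)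
    ultimately show ?thesis
      by (simp only: set_eq_iff UN_iff mem_Collect_eq space_M UNIV_I) blast
  qed
  also have "prob \<dots> \<le> (\<Sum>a\<in>UNIV. prob {x \<in> space M. block x 0 (Suc r) = replicate (Suc r) a})"
    by (rule finite_measure_subadditive_finite) (auto simp del: replicate_Suc intro!: block_eq_sets)
  also have "\<dots> = (\<Sum>a\<in>UNIV. word_prob M (replicate (Suc r) a))"
    by (simp add: word_prob_def del: replicate_Suc)
  also have "\<dots> \<le> (\<Sum>a\<in>(UNIV :: 'a set). c * exp (- h * real r))"
  proof (rule sum_mono)
    fix a :: 'a
    have "word_prob M (replicate (Suc r) a) \<le> c * exp (- h * real (Suc r))"
      by (rule runs) simp
    \<comment> \<open>There are \<open>Suc r\<close> equal symbols; the additional decay from one of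
      them is given away.\<close>
    also have "\<dots> \<le> c * exp (- h * real r)"
      using c_pos h_pos by (intro mult_left_mono) auto
    finally show "word_prob M (replicate (Suc r) a) \<le> c * exp (- h * real r)" .
  qed
  finally show ?thesis by (simp add: run_tail_def)
qed

lemma run_tail_tendsto_0: "run_tail \<longlonglongrightarrow> 0"
proof -
  have "((\<lambda>x. real CARD('a) * c * exp (- h * x)) \<longlongrightarrow> 0) at_top"
    using h_pos by real_asymp
  then show ?thesis
    unfolding run_tail_def using filterlim_compose filterlim_real_sequentially by blast
qed

text \<open>A sequence constant from \<open>N\<close> on lies in every \<open>long_run N r\<close>,
  whose probability tends to 0 as \<open>r\<close> grows.\<close>

lemma AE_not_eventually_constant: "AE x in M. \<not> eventually_constant x"
proof -
  have "AE x in M. x \<notin> (\<Inter>r. long_run N r)" for N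
  proof -
    have sets: "(\<Inter>r. long_run N r) \<in> events" by auto
    have "prob (\<Inter>r. long_run N r) \<le> run_tail r" for r
      using finite_measure_mono[of "\<Inter>r. long_run N r" "long_run N r"] prob_long_run[of N r]
      by (auto intro: order.trans)
    then have "prob (\<Inter>r. long_run N r) \<le> 0"
      using run_tail_tendsto_0 by (intro LIMSEQ_le_const) auto
    then show ?thesis
      using sets by (intro AE_not_in) (simp add: null_sets_def emeasure_eq_measure measure_le_0_iff)
  qed
  then have "AE x in M. \<forall>N. x \<notin> (\<Inter>r. long_run N r)"
    by (simp add: AE_all_countable)
  then show ?thesis
  proof eventually_elim
    case (elim x)
    then have "\<exists>j. x (N + Suc j) \<noteq> x N" for N
      unfolding long_run_def by blast
    then show ?case
      unfolding eventually_constant_def by (metis le_add1 order_refl)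
  qed
qed

lemma measurable_run_start_M [measurable]: "(\<lambda>x. run_start x i) \<in> measurable M (count_space UNIV)"
  using measurable_run_start measurable_cong_sets[OF sets_M refl] by blast

lemma measurable_block_rle [measurable]: "(\<lambda>x. block (rle x) i k) \<in> measurable M (count_space UNIV)"
proof -
  have [measurable]: "(\<lambda>x. rle x j) \<in> measurable M (count_space UNIV)" for j
  proof -
    have "rle \<in> measurable M seq_space"
      using measurable_rle measurable_cong_sets[OF sets_M refl] by blast
    moreover have "(\<lambda>z :: nat \<Rightarrow> 'a \<times> nat. z j) \<in> measurable seq_space (count_space UNIV)"
      unfolding seq_space_def by measurable
    ultimately show ?thesis by (rule measurable_compose)
  qed
  have "{x \<in> space M. block (rle x) i k = w} \<in> events" for w
  proof -
    have "{x \<in> space M. block (rle x) i k = w} =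
      {x \<in> space M. length w = k \<and> (\<forall>j<k. rle x (i + j) = w ! j)}"
      by (simp add: block_eq_word_iff)
    also have "\<dots> \<in> events" by measurable
    finally show ?thesis .
  qed
  then show ?thesis
    by (intro measurable_count_space_eq2_countable[THEN iffD2]) (auto simp: vimage_def Int_def conj_commute)
qed

text \<open>If \<open>k\<close> runs take more than \<open>k * r\<close> symbols, some position up
  to \<open>k * r\<close> begins a stretch of \<open>Suc r\<close> equal symbols; the bound is a
  union over these positions.\<close>

lemma prob_run_start_gt: "prob {x. k * r < run_start x k} \<le> (real (k * r) + 1) * run_tail r"
proof -
  have "prob {x. k * r < run_start x k} \<le> prob (\<Union>s\<in>{..k * r}. long_run s r)"
  proof (rule finite_measure_mono_AE)
    show "AE x in M. x \<in> {x. k * r < run_start x k} \<longrightarrow> x \<in> (\<Union>s\<in>{..k * r}. long_run s r)"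
      using AE_not_eventually_constant
    proof eventually_elim
      case (elim x)
      then show ?case
        using run_start_le_if_short_runs[OF elim, of k r] by (auto simp: long_run_def not_le[symmetric])
    qed
  qed auto
  also have "\<dots> \<le> (\<Sum>s\<in>{..k * r}. prob (long_run s r))"
    by (rule finite_measure_subadditive_finite) auto
  also have "\<dots> \<le> (\<Sum>s\<in>{..k * r}. run_tail r)"
    by (intro sum_mono prob_long_run)
  finally show ?thesis by (simp add: algebra_simps)
qed

section \<open>Collision probabilities of the encoding\<close>

abbreviation rle_prob :: "('a \<times> nat) list \<Rightarrow> real" where
  "rle_prob \<equiv> word_prob (rle_law M)"

lemma rle_prob_eq: "rle_prob w = prob {x. block (rle x) 0 (length w) = w}"
proof -
  have rle: "rle \<in> measurable M seq_space"
    using measurable_rle measurable_cong_sets[OF sets_M refl] by blast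
  have [measurable]: "(\<lambda>z :: nat \<Rightarrow> 'a \<times> nat. z j) \<in> measurable seq_space (count_space UNIV)" for j
    unfolding seq_space_def by measurable
  have "{z \<in> space seq_space. block z 0 (length w) = w} =
      {z \<in> space seq_space. \<forall>j<length w. z j = w ! j}"
    by (simp add: block_eq_word_iff)
  also have "\<dots> \<in> sets seq_space" by measurable
  finally show ?thesis
    unfolding word_prob_def rle_law_def
    by (subst measure_distr[OF rle]) (auto simp: vimage_def seq_space_def space_PiM)
qed

text \<open>Stationarity of \<open>M\<close> moves the window to 0, where the event says almost
  surely that the encoding begins with \<open>w\<close>; a short word fits into the window
  automatically. Hence the probability does not depend on \<open>s\<close>, although the law of the
  encoding need not be stationary.\<close>

lemma prob_window_event:
  assumes "w \<in> short_words k W"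
  shows "prob (window_event W s w) = rle_prob w"
proof -
  have "prob (window_event W s w) = prob (window_event W 0 w)"
    by (subst window_event_vimage) (rule prob_shift_vimage, simp)
  also have "\<dots> = prob {x. block (rle x) 0 (length w) = w}"
  proof (rule finite_measure_eq_AE)
    show "AE x in M. x \<in> window_event W 0 w \<longleftrightarrow> x \<in> {x. block (rle x) 0 (length w) = w}"
      using AE_not_eventually_constant
    proof eventually_elim
      case (elim x)
      have "run_start x (length w) \<le> W" if "block (rle x) 0 (length w) = w"
      proof -
        have "block (rle x) 0 (length w) \<in> short_words (length w) W"
          using assms that by (simp add: short_words_def)
        then show ?thesis
          using block_rle_in_short_words_iff[OF elim] by blast
      qed
      then show ?case
        by (auto simp: window_event_iff[OF elim])
    qed
    have "{x \<in> space M. block (rle x) 0 (length w) = w} \<in> events" by measurable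
    then show "{x. block (rle x) 0 (length w) = w} \<in> events" by simp
  qed simp
  finally show ?thesis by (simp add: rle_prob_eq)
qed

definition words :: "nat \<Rightarrow> ('a \<times> nat) list set" where
  "words k = {w. length w = k \<and> set w \<subseteq> rle_alphabet}"

lemma short_words_subset: "short_words k W \<subseteq> words k"
  by (auto simp: short_words_def words_def)

lemma sum_rle_prob:
  assumes "finite F" "F \<subseteq> words k"
  shows "(\<Sum>w\<in>F. rle_prob w) = prob {x. block (rle x) 0 k \<in> F}"
proof -
  have "(\<Sum>w\<in>F. rle_prob w) = (\<Sum>w\<in>F. prob {x. block (rle x) 0 k = w})"
    using assms(2) by (intro sum.cong) (auto simp: rle_prob_eq words_def)
  also have "\<dots> = prob (\<Union>w\<in>F. {x. block (rle x) 0 k = w})"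
  proof (rule finite_measure_finite_Union[symmetric, OF assms(1)])
    have "{x \<in> space M. block (rle x) 0 k = w} \<in> events" for w by measurable
    then show "(\<lambda>w. {x. block (rle x) 0 k = w}) ` F \<subseteq> events" by auto
  qed (auto simp: disjoint_family_on_def)
  also have "(\<Union>w\<in>F. {x. block (rle x) 0 k = w}) = {x. block (rle x) 0 k \<in> F}" by auto
  finally show ?thesis .
qed

lemma rle_prob_sq_le: "(rle_prob w)\<^sup>2 \<le> rle_prob w"
  by (simp add: rle_prob_eq power2_eq_square mult_left_le)

lemma sum_rle_prob_sq_le:
  assumes "finite F" "F \<subseteq> words k"
  shows "(\<Sum>w\<in>F. (rle_prob w)\<^sup>2) \<le> prob {x. block (rle x) 0 k \<in> F}"
  unfolding sum_rle_prob[OF assms, symmetric] by (intro sum_mono rle_prob_sq_le)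

lemma summable_rle_prob_sq: "F \<subseteq> words k \<Longrightarrow> (\<lambda>w. (rle_prob w)\<^sup>2) summable_on F"
  by (rule nonneg_bdd_above_summable_on)
    (auto intro!: bdd_aboveI2[where M = 1] order.trans[OF sum_rle_prob_sq_le])

definition collision :: "nat \<Rightarrow> real" where
  "collision k = (\<Sum>\<^sub>\<infinity>w\<in>words k. (rle_prob w)\<^sup>2)"

definition short_collision :: "nat \<Rightarrow> nat \<Rightarrow> real" where
  "short_collision k W = (\<Sum>w\<in>short_words k W. (rle_prob w)\<^sup>2)"

lemma collision_rate_eq: "collision_rate rle_alphabet (rle_law M) k = - (1 / real k) * ln (collision k)"
  by (simp add: collision_rate_def collision_def words_def)

lemma short_collision_le: "short_collision k W \<le> collision k"
  unfolding short_collision_def collision_def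
  by (rule finite_sum_le_infsum) (auto simp: summable_rle_prob_sq[OF order_refl] finite_short_words short_words_subset)

text \<open>For the remaining words \<open>rle_prob_sq_le\<close> replaces squares by probabilities.
  Their total is at most the probability that \<open>k\<close> runs do not fit into
  \<open>k * r\<close> symbols.\<close>

lemma collision_le_short_collision:
  "collision k \<le> short_collision k (k * r) + (real (k * r) + 1) * run_tail r"
proof -
  let ?S = "short_words k (k * r)"
  have "collision k = (\<Sum>\<^sub>\<infinity>w\<in>?S \<union> (words k - ?S). (rle_prob w)\<^sup>2)"
    unfolding collision_def using short_words_subset by (metis Un_Diff_cancel Un_absorb1)
  also have "\<dots> = (\<Sum>\<^sub>\<infinity>w\<in>?S. (rle_prob w)\<^sup>2) + (\<Sum>\<^sub>\<infinity>w\<in>words k - ?S. (rle_prob w)\<^sup>2)"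
    using summable_rle_prob_sq[OF short_words_subset] summable_rle_prob_sq[OF Diff_subset]
    by (rule infsum_Un_disjoint) auto
  also have "(\<Sum>\<^sub>\<infinity>w\<in>?S. (rle_prob w)\<^sup>2) = short_collision k (k * r)"
    by (simp add: short_collision_def finite_short_words)
  also have "(\<Sum>\<^sub>\<infinity>w\<in>words k - ?S. (rle_prob w)\<^sup>2) \<le> (real (k * r) + 1) * run_tail r"
  proof (rule infsum_le_finite_sums)
    show "(\<lambda>w. (rle_prob w)\<^sup>2) summable_on words k - ?S"
      by (rule summable_rle_prob_sq) auto
    fix F assume F: "finite F" "F \<subseteq> words k - ?S"
    then have "(\<Sum>w\<in>F. (rle_prob w)\<^sup>2) \<le> prob {x. block (rle x) 0 k \<in> F}"
      by (intro sum_rle_prob_sq_le) auto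
    also have "\<dots> \<le> prob {x. k * r < run_start x k}"
    proof (rule finite_measure_mono_AE)
      show "AE x in M. x \<in> {x. block (rle x) 0 k \<in> F} \<longrightarrow> x \<in> {x. k * r < run_start x k}"
        using AE_not_eventually_constant
      proof eventually_elim
        case (elim x)
        show ?case
          using block_rle_in_short_words_iff[OF elim, of k "k * r"] F(2) by auto
      qed
      have "{x \<in> space M. k * r < run_start x k} \<in> events" by measurable
      then show "{x. k * r < run_start x k} \<in> events" by simp
    qed
    also have "\<dots> \<le> (real (k * r) + 1) * run_tail r"
      by (rule prob_run_start_gt)
    finally show "(\<Sum>w\<in>F. (rle_prob w)\<^sup>2) \<le> (real (k * r) + 1) * run_tail r" .
  qed
  finally show ?thesis by simp
qed

text \<open>Positivity lets the logarithm in \<open>collision_rate\<close> be inverted. Were the sum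
  zero, all of the countably many words would be null, yet almost every encoding begins with one of
  them.\<close>

lemma collision_pos: "collision k > 0"
proof (rule ccontr)
  assume "\<not> collision k > 0"
  have 0: "rle_prob w = 0" if "w \<in> words k" for w
  proof -
    have "(rle_prob w)\<^sup>2 \<le> collision k"
      using finite_sum_le_infsum[OF summable_rle_prob_sq[OF order_refl], of "{w}" k] that
      by (simp add: collision_def)
    with \<open>\<not> collision k > 0\<close> have "(rle_prob w)\<^sup>2 \<le> 0" by linarith
    then show ?thesis by simp
  qed
  have "AE x in M. \<forall>w\<in>words k. block (rle x) 0 k \<noteq> w"
  proof (subst AE_ball_countable)
    have "countable ((UNIV :: 'a set) \<times> (UNIV :: nat set))"
      by (intro countable_SIGMA) (auto intro: countable_finite)
    then have "countable (lists (UNIV :: ('a \<times> nat) set))"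
      by (simp only: UNIV_Times_UNIV countable_lists)
    then show "countable (words k)"
      by (rule countable_subset[rotated]) auto
    show "\<forall>w\<in>words k. AE x in M. block (rle x) 0 k \<noteq> w"
    proof
      fix w assume w: "w \<in> words k"
      have "{x \<in> space M. block (rle x) 0 k = w} \<in> events" by measurable
      then show "AE x in M. block (rle x) 0 k \<noteq> w"
        using 0[OF w] w
        by (intro AE_I[where N = "{x. block (rle x) 0 k = w}"])
          (auto simp: rle_prob_eq words_def emeasure_eq_measure)
    qed
  qed
  then have "AE x in M. False"
    using AE_not_eventually_constant
  proof eventually_elim
    case (elim x)
    then show ?case
    proof -
      have "block (rle x) 0 k \<in> words k"
        using block_rle_subset[OF elim(2)] by (simp add: words_def)
      then show ?thesis using elim(1) by blast
    qed
  qed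
  then show False by simp
qed

section \<open>Exceptional events for the two bounds\<close>

definition upper_bad :: "nat \<Rightarrow> nat \<Rightarrow> nat \<Rightarrow> ((nat \<Rightarrow> 'a) \<times> (nat \<Rightarrow> 'a)) set" where
  "upper_bad n r k =
    {x. n * r < run_start x n} \<times> UNIV \<union> UNIV \<times> {x. n * r < run_start x n} \<union>
    (\<Union>(s, t)\<in>{..n * r} \<times> {..n * r}. \<Union>w\<in>short_words k (n * r). window_event (n * r) s w \<times> window_event (n * r) t w)"

lemma measure_Times:
  assumes "A \<in> events" "B \<in> events"
  shows "measure (M \<Otimes>\<^sub>M M) (A \<times> B) = prob A * prob B"
  using assms by (simp add: measure_def emeasure_pair_measure_Times enn2real_mult)

lemma run_start_gt_sets [measurable]: "{x. n < run_start x k} \<in> events"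
proof -
  have "{x \<in> space M. n < run_start x k} \<in> events" by measurable
  then show ?thesis by simp
qed

lemma upper_bad_sets: "upper_bad n r k \<in> sets (M \<Otimes>\<^sub>M M)"
proof -
  have U: "UNIV \<in> events" using sets.top[of M] by simp
  show ?thesis
    unfolding upper_bad_def using U by (intro sets.Un sets.finite_UN)
      (auto intro!: sets.finite_UN simp: finite_short_words)
qed

text \<open>A union bound: the two sequences are independent, so for fixed \<open>s\<close> and
  \<open>t\<close> the word \<open>w\<close> contributes the square of its probability, and the sum
  over words is a collision probability.\<close>

lemma measure_upper_bad:
  "measure (M \<Otimes>\<^sub>M M) (upper_bad n r k) \<le>
    2 * ((real (n * r) + 1) * run_tail r) + (real (n * r) + 1)\<^sup>2 * collision k"
proof -
  interpret P: pair_prob_space M M ..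
  let ?L = "{x. n * r < run_start x n}"
  let ?W = "\<lambda>s t. \<Union>w\<in>short_words k (n * r). window_event (n * r) s w \<times> window_event (n * r) t w"
  have U: "UNIV \<in> events" using sets.top[of M] by simp
  have W_sets: "?W s t \<in> sets (M \<Otimes>\<^sub>M M)" for s t
    by (auto intro!: sets.finite_UN simp: finite_short_words)
  have W: "P.prob (?W s t) \<le> collision k" for s t
  proof -
    have "P.prob (?W s t) \<le> (\<Sum>w\<in>short_words k (n * r). P.prob (window_event (n * r) s w \<times> window_event (n * r) t w))"
      by (rule P.finite_measure_subadditive_finite) (auto simp: finite_short_words)
    also have "\<dots> = short_collision k (n * r)"
      unfolding short_collision_def
      by (intro sum.cong) (auto simp: measure_Times prob_window_event power2_eq_square)
    finally show ?thesis using short_collision_le order.trans by blast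
  qed
  have "P.prob (\<Union>(s, t)\<in>{..n * r} \<times> {..n * r}. ?W s t)
      \<le> (\<Sum>(s, t)\<in>{..n * r} \<times> {..n * r}. P.prob (?W s t))"
    unfolding case_prod_beta by (rule P.finite_measure_subadditive_finite) (use W_sets in auto)
  also have "\<dots> \<le> (\<Sum>(s, t)\<in>{..n * r} \<times> {..n * r}. collision k)"
    unfolding case_prod_beta by (intro sum_mono W)
  also have "\<dots> = (real (n * r) + 1)\<^sup>2 * collision k"
    by (simp add: power2_eq_square algebra_simps)
  finally have 1: "P.prob (\<Union>(s, t)\<in>{..n * r} \<times> {..n * r}. ?W s t) \<le> (real (n * r) + 1)\<^sup>2 * collision k" .
  have 2: "P.prob (?L \<times> UNIV) \<le> (real (n * r) + 1) * run_tail r" "P.prob (UNIV \<times> ?L) \<le> (real (n * r) + 1) * run_tail r"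
    using prob_run_start_gt[of n r] U prob_space by (simp_all add: measure_Times)
  have "P.prob (upper_bad n r k) \<le>
      P.prob (?L \<times> UNIV) + P.prob (UNIV \<times> ?L) + P.prob (\<Union>(s, t)\<in>{..n * r} \<times> {..n * r}. ?W s t)"
    unfolding upper_bad_def using U W_sets
    by (intro order.trans[OF measure_Un_le] add_mono order_refl) (auto intro!: sets.finite_UN finite_short_words)
  with 1 2 show ?thesis by linarith
qed

lemma longest_common_rle_less:
  assumes "\<not> eventually_constant x" "\<not> eventually_constant y" "(x, y) \<notin> upper_bad n r k"
  shows "longest_common_rle n x y < k"
proof (rule ccontr)
  assume "\<not> longest_common_rle n x y < k"
  moreover have "run_start x n \<le> n * r" "run_start y n \<le> n * r"
    using assms(3) by (auto simp: upper_bad_def)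
  ultimately obtain s t w where "s \<le> n * r" "t \<le> n * r" "w \<in> short_words k (n * r)"
    "x \<in> window_event (n * r) s w" "y \<in> window_event (n * r) t w"
    using window_of_longest_common_rle[OF assms(1,2), of n "n * r" k] by auto
  then show False
    using assms(3) unfolding upper_bad_def by blast
qed

text \<open>With windows of length \<open>W = k r\<close> at the multiples of \<open>2 W\<close>, distinct windows are
  separated by a gap of length at least \<open>W\<close>.\<close>

definition lower_bad :: "nat \<Rightarrow> nat \<Rightarrow> nat \<Rightarrow> ((nat \<Rightarrow> 'a) \<times> (nat \<Rightarrow> 'a)) set" where
  "lower_bad m r k = space (M \<Otimes>\<^sub>M M) - (\<Union>i<m. \<Union>j<m. \<Union>w\<in>short_words k (k * r).
     window_event (k * r) (i * (2 * (k * r))) w \<times> window_event (k * r) (j * (2 * (k * r))) w)"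

lemma lower_bad_sets: "lower_bad m r k \<in> sets (M \<Otimes>\<^sub>M M)"
  unfolding lower_bad_def by (intro sets.Diff sets.finite_UN) (auto simp: finite_short_words)

lemma longest_common_rle_ge:
  assumes "\<not> eventually_constant x" "\<not> eventually_constant y" "(x, y) \<notin> lower_bad m r k"
    and le: "m * (2 * (k * r)) + k \<le> n"
  shows "k - 1 \<le> longest_common_rle n x y"
proof -
  from assms(3) obtain i j w where ij: "i < m" "j < m" and w: "w \<in> short_words k (k * r)"
    "x \<in> window_event (k * r) (i * (2 * (k * r))) w" "y \<in> window_event (k * r) (j * (2 * (k * r))) w"
    by (auto simp: lower_bad_def space_pair_measure)
  have len: "length w = k" using w(1) by (simp add: short_words_def)
  have "l * (2 * (k * r)) + k \<le> n" if "l < m" for l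
    using le mult_le_mono1[OF less_imp_le[OF that], of "2 * (k * r)"] by linarith
  then show ?thesis
    using longest_common_rle_ge_of_window[OF assms(1,2) w(2,3), of n] ij len by simp
qed

lemma measure_lower_bad:
  assumes mix: "\<And>n g A B. g \<ge> 1 \<Longrightarrow> A \<in> coord_sigma 0 (enat n) \<Longrightarrow> B \<in> coord_sigma (n + g) \<infinity> \<Longrightarrow>
      prob (A \<inter> B) \<le> (1 + real g powr (- a)) * (prob A * prob B) + C * exp (- \<kappa> * real g)"
    and a: "a > 0" and C: "C \<ge> 0" and \<kappa>: "\<kappa> > 0"
    and pos: "k \<ge> 1" "r \<ge> 1" "m \<ge> 1"
    and Z: "0 < Z" "Z \<le> short_collision k (k * r)"
  shows "measure (M \<Otimes>\<^sub>M M) (lower_bad m r k) \<le>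
    3 * real r powr (- a) + 5 * (C * exp (- \<kappa> * real r)) / Z\<^sup>2
      + 4 / (real m * sqrt Z) + 1 / (real m * sqrt Z)\<^sup>2"
proof -
  define W where "W = k * r"
  define S where "S = short_collision k W"
  have W: "W \<ge> r" "W \<ge> 1" using pos by (auto simp: W_def)
  have ZS: "Z \<le> S" using Z by (simp add: S_def W_def)
  have S_pos: "S > 0" using Z ZS by simp
  let ?\<theta> = "real r powr (- a)" and ?\<eta> = "C * exp (- \<kappa> * real r)"
  have th: "?\<theta> \<le> 1" using pos a by (simp add: powr_minus divide_simps ge_one_powr_ge_zero)
  have "measure (M \<Otimes>\<^sub>M M) (lower_bad m r k) \<le>
    3 * ?\<theta> + 5 * ?\<eta> / S\<^sup>2 + 4 / (real m * sqrt S) + 1 / (real m * sqrt S)\<^sup>2"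
    unfolding lower_bad_def W_def[symmetric]
  proof (rule prob_no_coincidence_le[where p = rle_prob])
    fix i j :: nat and w w' :: "('a \<times> nat) list" assume ij: "i < j" and w: "w \<in> short_words k W" "w' \<in> short_words k W"
    let ?A = "window_event W (i * (2 * W)) w" and ?B = "window_event W (j * (2 * W)) w'"
    \<comment> \<open>The gap between the two windows is at least \<open>W \<ge> r\<close>. Both
      error terms decrease with the gap, so their values at \<open>r\<close> serve for all
      pairs.\<close>
    define g where "g = j * (2 * W) - (i * (2 * W) + W)"
    have "Suc i * (2 * W) \<le> j * (2 * W)"
      using ij by (intro mult_le_mono1) simp
    then have g: "g \<ge> W" "j * (2 * W) = (i * (2 * W) + W) + g"
      by (auto simp: g_def)
    have "?A \<in> coord_sigma 0 (enat (i * (2 * W) + W))"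
      by (rule subsetD[OF coord_sigma_mono window_event_coord_sigma]) auto
    moreover have "?B \<in> coord_sigma ((i * (2 * W) + W) + g) \<infinity>"
      unfolding g(2)[symmetric] by (rule subsetD[OF coord_sigma_mono window_event_coord_sigma]) auto
    ultimately have "prob (?A \<inter> ?B) \<le>
        (1 + real g powr (- a)) * (prob ?A * prob ?B) + C * exp (- \<kappa> * real g)"
      using g W by (intro mix) auto
    also have "\<dots> \<le> (1 + ?\<theta>) * (prob ?A * prob ?B) + ?\<eta>"
    proof (intro add_mono mult_right_mono mult_left_mono)
      show "real g powr (- a) \<le> ?\<theta>"
        using g(1) W pos a by (intro powr_mono2') auto
      show "exp (- \<kappa> * real g) \<le> exp (- \<kappa> * real r)"
        using g(1) W \<kappa> by simp
    qed (use C in auto)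
    finally show "prob (?A \<inter> ?B) \<le> (1 + ?\<theta>) * (rle_prob w * rle_prob w') + ?\<eta>"
      using w by (simp add: prob_window_event)
  next
    fix i and w w' :: "('a \<times> nat) list" assume "w \<in> short_words k W" "w' \<in> short_words k W" "w \<noteq> w'"
    then show "window_event W (i * (2 * W)) w \<inter> window_event W (i * (2 * W)) w' = {}"
      by (intro window_event_disjoint) (auto simp: short_words_def)
  qed (use pos th C S_pos in \<open>auto simp: finite_short_words prob_window_event S_def short_collision_def\<close>)
  \<comment> \<open>The bound decreases in the collision sum, so its lower bound \<open>Z\<close>
    may be inserted.\<close>
  also have "\<dots> \<le> 3 * ?\<theta> + 5 * ?\<eta> / Z\<^sup>2 + 4 / (real m * sqrt Z) + 1 / (real m * sqrt Z)\<^sup>2"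
    using Z(1) ZS C pos
    by (intro add_mono divide_left_mono power_mono mult_left_mono mult_pos_pos zero_less_power) auto
  finally show ?thesis .
qed

end

section \<open>Interpolation along powers of two\<close>

lemma dyadic_interval:
  assumes "n \<ge> (1 :: nat)"
  obtains l where "2 ^ l \<le> n" "n < 2 ^ Suc l" "real l * ln 2 \<le> ln (real n)" "ln (real n) \<le> real (Suc l) * ln 2"
proof -
  obtain l where l: "2 ^ l \<le> n" "n < 2 ^ Suc l"
    using ex_power_ivl1[of 2 n] assms by auto
  have "real l * ln 2 = ln (2 ^ l)" by (simp add: ln_realpow)
  also have "\<dots> \<le> ln (real n)" using l(1) assms by (subst ln_le_cancel_iff) (auto simp: numeral_power_le_of_nat_cancel_iff)
  finally have 1: "real l * ln 2 \<le> ln (real n)" .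
  have "real n \<le> 2 ^ Suc l" using l(2) by (metis less_imp_le of_nat_le_numeral_power_cancel_iff)
  then have "ln (real n) \<le> ln (2 ^ Suc l)" using assms by (subst ln_le_cancel_iff) auto
  also have "\<dots> = real (Suc l) * ln 2" by (rule ln_realpow)
  finally show thesis using that l 1 by blast
qed

text \<open>Between consecutive powers of two \<open>f\<close> is controlled by monotonicity, and ln
  n exceeds l ln 2 by at most ln 2, which is negligible against ln n.\<close>

lemma liminf_div_ln_ge:
  fixes f :: "nat \<Rightarrow> nat" and b :: real
  assumes mono: "\<And>n n'. n \<le> n' \<Longrightarrow> f n \<le> f n'" and b: "b \<ge> 0"
    and ev: "\<forall>\<^sub>F l in sequentially. b * (real l * ln 2) \<le> real (f (2 ^ l))"
  shows "ereal b \<le> liminf (\<lambda>n. ereal (real (f n) / ln (real n)))"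
proof -
  obtain L where L: "\<And>l. l \<ge> L \<Longrightarrow> b * (real l * ln 2) \<le> real (f (2 ^ l))"
    using ev unfolding eventually_sequentially by blast
  have lim: "(\<lambda>n. ereal (b * (1 - ln 2 / ln (real n)))) \<longlonglongrightarrow> ereal b"
  proof -
    have "(\<lambda>n. b * (1 - ln 2 / ln (real n))) \<longlonglongrightarrow> b" by real_asymp
    then show ?thesis by simp
  qed
  have "\<forall>\<^sub>F n in sequentially. ereal (b * (1 - ln 2 / ln (real n))) \<le> ereal (real (f n) / ln (real n))"
    \<comment> \<open>The summand 2 makes ln n positive; the power places the dyadic exponent of n
      at \<open>L\<close> or above.\<close>
    using eventually_ge_at_top[of "2 ^ L + 2"]
  proof eventually_elim
    case (elim n)
    then obtain l where l: "2 ^ l \<le> n" "n < 2 ^ Suc l" "ln (real n) \<le> real (Suc l) * ln 2"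
      using dyadic_interval[of n] by auto
    have "(2 :: nat) ^ L < 2 ^ Suc l" using elim l(2) by linarith
    then have "L \<le> l" by (metis less_Suc_eq_le one_less_numeral_iff power_less_imp_less_exp semiring_norm(76))
    have "b * (ln (real n) - ln 2) \<le> b * (real l * ln 2)"
      using l(3) b by (intro mult_left_mono) (auto simp: algebra_simps)
    also have "\<dots> \<le> real (f (2 ^ l))" by (rule L) fact
    also have "\<dots> \<le> real (f n)" using mono l(1) by simp
    finally have "b * (ln (real n) - ln 2) \<le> real (f n)" .
    moreover have pos: "ln (real n) > 0" using elim by simp
    ultimately have "b * (ln (real n) - ln 2) / ln (real n) \<le> real (f n) / ln (real n)"
      by (intro divide_right_mono) auto
    then show ?case
      using pos by (simp add: diff_divide_distrib add_divide_distrib flip: times_divide_eq_right)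
  qed
  from Liminf_mono[OF this] show ?thesis
    by (simp add: lim_imp_Liminf[OF _ lim])
qed

lemma limsup_div_ln_le:
  fixes f :: "nat \<Rightarrow> nat" and b :: real
  assumes mono: "\<And>n n'. n \<le> n' \<Longrightarrow> f n \<le> f n'" and b: "b \<ge> 0"
    and ev: "\<forall>\<^sub>F l in sequentially. real (f (2 ^ l)) \<le> b * (real l * ln 2)"
  shows "limsup (\<lambda>n. ereal (real (f n) / ln (real n))) \<le> ereal b"
proof -
  obtain L where L: "\<And>l. l \<ge> L \<Longrightarrow> real (f (2 ^ l)) \<le> b * (real l * ln 2)"
    using ev unfolding eventually_sequentially by blast
  have lim: "(\<lambda>n. ereal (b * (1 + ln 2 / ln (real n)))) \<longlonglongrightarrow> ereal b"
  proof -
    have "(\<lambda>n. b * (1 + ln 2 / ln (real n))) \<longlonglongrightarrow> b" by real_asymp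
    then show ?thesis by simp
  qed
  have "\<forall>\<^sub>F n in sequentially. ereal (real (f n) / ln (real n)) \<le> ereal (b * (1 + ln 2 / ln (real n)))"
    using eventually_ge_at_top[of "2 ^ L + 2"]
  proof eventually_elim
    case (elim n)
    then obtain l where l: "n < 2 ^ Suc l" "real l * ln 2 \<le> ln (real n)"
      using dyadic_interval[of n] by auto
    have "(2 :: nat) ^ L < 2 ^ Suc l" using elim l(1) by linarith
    then have "L \<le> Suc l" by (metis less_imp_le one_less_numeral_iff power_less_imp_less_exp semiring_norm(76))
    have "real (f n) \<le> real (f (2 ^ Suc l))" using mono l(1) by simp
    also have "\<dots> \<le> b * (real (Suc l) * ln 2)" by (rule L) fact
    also have "\<dots> \<le> b * (ln (real n) + ln 2)"
      using l(2) b by (intro mult_left_mono) (auto simp: algebra_simps)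
    finally have "real (f n) \<le> b * (ln (real n) + ln 2)" .
    moreover have pos: "ln (real n) > 0" using elim by simp
    ultimately have "real (f n) / ln (real n) \<le> b * (ln (real n) + ln 2) / ln (real n)"
      by (intro divide_right_mono) auto
    then show ?case
      using pos by (simp add: diff_divide_distrib add_divide_distrib flip: times_divide_eq_right)
  qed
  from Limsup_mono[OF this] show ?thesis
    by (simp add: lim_imp_Limsup[OF _ lim])
qed

lemma filterlim_dyadic: "filterlim (\<lambda>l :: nat. 2 ^ l :: real) at_top sequentially"
  by real_asymp

text \<open>Polynomial decay in n, however slow, becomes geometric decay in l along n = 2^l.\<close>

lemma summable_dyadic:
  fixes f :: "real \<Rightarrow> real"
  assumes "f \<in> O(\<lambda>x. x powr (- e))" "e > 0"
  shows "summable (\<lambda>l :: nat. f (2 ^ l))"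
proof (rule summable_comparison_test_bigo)
  show "(\<lambda>l :: nat. f (2 ^ l)) \<in> O(\<lambda>l. (2 ^ l) powr (- e))"
    using landau_o.big.compose[OF assms(1) filterlim_dyadic] .
  have "((2 :: real) ^ l) powr (- e) = (2 powr (- e)) ^ l" for l :: nat
    by (simp add: powr_powr mult.commute flip: powr_realpow)
  moreover have "summable (\<lambda>l. ((2 :: real) powr (- e)) ^ l)"
    using assms(2) by (intro summable_geometric) (simp add: powr_minus_divide gr_one_powr)
  ultimately show "summable (\<lambda>l :: nat. norm (((2 :: real) ^ l) powr (- e)))"
    by simp
qed

section \<open>Borel-Cantelli and the choice of scales\<close>

context exponential_run_source
begin

lemma AE_pair_fst_snd:
  assumes "AE x in M. P x"
  shows "AE z in M \<Otimes>\<^sub>M M. P (fst z) \<and> P (snd z)"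
proof -
  obtain N where N: "N \<in> null_sets M" "{x \<in> space M. \<not> P x} \<subseteq> N"
    using assms by (auto simp: eventually_ae_filter)
  have U: "UNIV \<in> events" using sets.top[of M] by simp
  have "AE z in M \<Otimes>\<^sub>M M. z \<notin> N \<times> UNIV" "AE z in M \<Otimes>\<^sub>M M. z \<notin> UNIV \<times> N"
    using N(1) U by (auto intro!: AE_not_in simp: null_sets_def emeasure_pair_measure_Times)
  then show ?thesis
  proof eventually_elim
    case (elim z)
    then show ?case using N(2) by (cases z) auto
  qed
qed

text \<open>Borel-Cantelli for the exceptional events, merged with the null set of pairs to which
  the deterministic comparisons do not apply.\<close>

lemma AE_eventually_not_bad:
  assumes "\<And>l. D l \<in> sets (M \<Otimes>\<^sub>M M)" "summable B"
    and "\<forall>\<^sub>F l in sequentially. measure (M \<Otimes>\<^sub>M M) (D l) \<le> B l"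
  shows "AE z in M \<Otimes>\<^sub>M M. \<not> eventually_constant (fst z) \<and> \<not> eventually_constant (snd z) \<and>
    (\<forall>\<^sub>F l in sequentially. z \<notin> D l)"
proof -
  interpret P: pair_prob_space M M ..
  have "summable (\<lambda>l. P.prob (D l))"
    by (rule summable_comparison_test_ev[OF _ assms(2)]) (use assms(3) in simp)
  then have "AE z in M \<Otimes>\<^sub>M M. \<forall>\<^sub>F l in sequentially. z \<in> space (M \<Otimes>\<^sub>M M) - D l"
    using assms(1) by (intro borel_cantelli_AE1) (auto simp: P.emeasure_eq_measure)
  with AE_pair_fst_snd[OF AE_not_eventually_constant] show ?thesis
    by eventually_elim (auto elim: eventually_mono)
qed

lemma eventually_collision_le:
  assumes "ereal H < lower_renyi2 rle_alphabet (rle_law M)"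
  shows "\<forall>\<^sub>F k in sequentially. collision k \<le> exp (- H * real k)"
proof -
  have "\<forall>\<^sub>F k in sequentially. ereal H < ereal (collision_rate rle_alphabet (rle_law M) k)"
    using assms unfolding lower_renyi2_def by (rule less_LiminfD)
  then show ?thesis
    using eventually_gt_at_top[of 0]
  proof eventually_elim
    case (elim k)
    then have "ln (collision k) \<le> - H * real k"
      by (simp add: collision_rate_eq field_simps)
    then show ?case
      using collision_pos[of k] by (metis exp_le_cancel_iff exp_ln)
  qed
qed

lemma eventually_collision_ge:
  assumes "upper_renyi2 rle_alphabet (rle_law M) < ereal H"
  shows "\<forall>\<^sub>F k in sequentially. exp (- H * real k) \<le> collision k"
proof -
  have "\<forall>\<^sub>F k in sequentially. ereal (collision_rate rle_alphabet (rle_law M) k) < ereal H"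
    using assms unfolding upper_renyi2_def by (rule Limsup_lessD)
  then show ?thesis
    using eventually_gt_at_top[of 0]
  proof eventually_elim
    case (elim k)
    then have "- H * real k \<le> ln (collision k)"
      by (simp add: collision_rate_eq field_simps)
    then show ?case
      using collision_pos[of k] by (metis exp_le_cancel_iff exp_ln)
  qed
qed

text \<open>At n = 2^l, with r about n^\<delta> and k about b ln n, the collision probability is at
  most n^(-b H). This beats the number of pairs of positions, of order n^(2 + 2 \<delta>), since b H
  exceeds 2.\<close>

lemma AE_limsup_le:
  fixes b H :: real
  assumes H: "ereal H < lower_renyi2 rle_alphabet (rle_law M)" and b: "b > 0" "b * H > 2"
  shows "AE z in M \<Otimes>\<^sub>M M.
    limsup (\<lambda>n. ereal (real (longest_common_rle n (fst z) (snd z)) / ln (real n))) \<le> ereal b"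
proof -
  \<comment> \<open>A quarter of the slack: the main term gets the exponent 2 (1 + \<delta>) - (2 +
    4 \<delta>) = -2 \<delta>.\<close>
  define \<delta> where "\<delta> = (b * H - 2) / 4"
  have \<delta>: "\<delta> > 0" "b * H = 2 + 4 * \<delta>" using b by (auto simp: \<delta>_def field_simps)
  have H_pos: "H > 0" using b by (smt (verit) mult_nonneg_nonpos)
  define r where "r l = nat \<lceil>(2 ^ l) powr \<delta>\<rceil>" for l :: nat
  define k where "k l = nat \<lceil>b * ln (2 ^ l)\<rceil>" for l :: nat
  define K where "K = real CARD('a) * c"
  have K: "K > 0" using c_pos by (simp add: K_def)
  \<comment> \<open>The constants stem from the estimate
    \<open>real (2 ^ l * r l) + 1 \<le> 3 * x powr (1 + \<delta>)\<close>: 6 = 2 * 3 for overlong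
    encodings of either sequence, 9 = 3 * 3 for the pairs of positions.\<close>
  define F where "F x = 6 * K * x powr (1 + \<delta>) * exp (- h * x powr \<delta>) + 9 * x powr (- (2 * \<delta>))" for x
  have F: "summable (\<lambda>l :: nat. F (2 ^ l))"
  proof -
    have "(\<lambda>x. 6 * K * x powr (1 + \<delta>) * exp (- h * x powr \<delta>)) \<in> O(\<lambda>x. x powr (- 1))"
      using h_pos \<delta>(1) K by real_asymp
    from summable_dyadic[OF this] have "summable (\<lambda>l :: nat. 6 * K * (2 ^ l) powr (1 + \<delta>) * exp (- h * (2 ^ l) powr \<delta>))"
      by simp
    moreover have "summable (\<lambda>l :: nat. 9 * (2 ^ l :: real) powr (- (2 * \<delta>)))"
      using \<delta>(1) by (intro summable_dyadic[of "\<lambda>x. 9 * x powr (- (2 * \<delta>))" "2 * \<delta>"]) auto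
    ultimately show ?thesis
      unfolding F_def by (rule summable_add)
  qed
  have k_lim: "filterlim k at_top sequentially"
  proof -
    have "filterlim (\<lambda>l :: nat. b * ln (2 ^ l)) at_top sequentially"
      using b(1) by real_asymp
    then have "filterlim (\<lambda>l. real (k l)) at_top sequentially"
      by (rule filterlim_at_top_mono) (auto simp: k_def intro!: always_eventually; linarith)
    then show ?thesis
      by (simp add: filterlim_sequentially_iff_filterlim_real)
  qed
  have "\<forall>\<^sub>F l in sequentially. measure (M \<Otimes>\<^sub>M M) (upper_bad (2 ^ l) (r l) (k l)) \<le> F (2 ^ l)"
    using eventually_compose_filterlim[OF eventually_collision_le[OF H] k_lim]
  proof eventually_elim
    case (elim l)
    define x :: real where "x = 2 ^ l"
    have x: "x \<ge> 1" by (simp add: x_def)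
    have r: "x powr \<delta> \<le> real (r l)" "real (r l) \<le> x powr \<delta> + 1"
      unfolding r_def x_def[symmetric] using powr_ge_zero[of x \<delta>] by linarith+
    have "x powr \<delta> \<ge> 1" using x \<delta>(1) by (simp add: ge_one_powr_ge_zero)
    have "real (2 ^ l * r l) + 1 \<le> x * (2 * x powr \<delta>) + 1 * x powr \<delta>"
    proof -
      have "x * real (r l) \<le> x * (2 * x powr \<delta>)"
        using r(2) x \<open>x powr \<delta> \<ge> 1\<close> by (intro mult_left_mono) auto
      then show ?thesis
        using \<open>x powr \<delta> \<ge> 1\<close> by (simp add: x_def[symmetric])
    qed
    also have "\<dots> \<le> x * (2 * x powr \<delta>) + x * x powr \<delta>"
      using x by (intro add_left_mono mult_right_mono) auto
    also have "\<dots> = 3 * x powr (1 + \<delta>)"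
      using x by (simp add: powr_add)
    finally have N: "real (2 ^ l * r l) + 1 \<le> 3 * x powr (1 + \<delta>)" .
    have tail: "run_tail (r l) \<le> K * exp (- h * x powr \<delta>)"
      unfolding run_tail_def K_def using r(1) h_pos c_pos by (intro mult_left_mono) auto
    have "b * ln x \<le> real (k l)"
      unfolding k_def x_def[symmetric] by linarith
    then have "exp (- H * real (k l)) \<le> exp (- H * (b * ln x))"
      using H_pos by simp
    also have "\<dots> = x powr (- (b * H))"
      using x by (simp add: powr_def algebra_simps)
    finally have Z: "collision (k l) \<le> x powr (- (b * H))"
      using elim by linarith
    have "measure (M \<Otimes>\<^sub>M M) (upper_bad (2 ^ l) (r l) (k l)) \<le>
        2 * ((real (2 ^ l * r l) + 1) * run_tail (r l)) + (real (2 ^ l * r l) + 1)\<^sup>2 * collision (k l)"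
      by (rule measure_upper_bad)
    also have "\<dots> \<le> 2 * ((3 * x powr (1 + \<delta>)) * (K * exp (- h * x powr \<delta>))) +
        (3 * x powr (1 + \<delta>))\<^sup>2 * x powr (- (b * H))"
      using N tail Z run_tail_nonneg collision_pos[of "k l"]
      by (intro add_mono mult_left_mono mult_mono power_mono) (auto simp: less_imp_le)
    also have "\<dots> = F x"
    proof -
      have "(x powr (1 + \<delta>))\<^sup>2 * x powr (- (b * H)) = x powr ((1 + \<delta>) + (1 + \<delta>) + - (b * H))"
        unfolding power2_eq_square by (simp only: powr_add)
      also have "(1 + \<delta>) + (1 + \<delta>) + - (b * H) = - (2 * \<delta>)"
        by (simp add: \<delta>(2))
      finally show ?thesis
        by (simp add: F_def power_mult_distrib)
    qed
    finally show ?case by (simp add: x_def)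
  qed
  from AE_eventually_not_bad[OF upper_bad_sets F this] show ?thesis
  proof eventually_elim
    case (elim z)
    have "\<forall>\<^sub>F l in sequentially. real (longest_common_rle (2 ^ l) (fst z) (snd z)) \<le> b * (real l * ln 2)"
      using elim[THEN conjunct2, THEN conjunct2]
    proof eventually_elim
      case bad: (elim l)
      have "longest_common_rle (2 ^ l) (fst z) (snd z) < k l"
        using elim bad by (intro longest_common_rle_less[of _ _ _ "r l"]) auto
      \<comment> \<open>An integer strictly below the ceiling of a real is below that real, so
        rounding costs nothing.\<close>
      then have "real (longest_common_rle (2 ^ l) (fst z) (snd z)) \<le> b * ln (2 ^ l)"
        unfolding k_def by linarith
      then show ?case by (simp add: ln_realpow)
    qed
    then show ?case
      using b(1) by (intro limsup_div_ln_le) (auto simp: longest_common_rle_def longest_common_mono)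
  qed
qed

text \<open>At n = 2^l there are at least n^(1 - 2 \<delta>) / 16 windows, while sqrt Z is of order
  n^(-b H / 2) = n^(-1 + 4 \<delta>). So m sqrt Z is at least of order n^(2 \<delta>), and every
  term of the second moment bound decays at least polynomially.\<close>

lemma AE_liminf_ge:
  fixes b H :: real
  assumes mixing: "alpha_mixing_exponential M \<or> (\<exists>a :: real. a > 0 \<and> psi_mixing M (\<lambda>g. real g powr (- a)))"
    and U: "upper_renyi2 rle_alphabet (rle_law M) < ereal H" and H: "H > 0" and b: "b > 0" "b * H < 2"
  shows "AE z in M \<Otimes>\<^sub>M M.
    ereal b \<le> liminf (\<lambda>n. ereal (real (longest_common_rle n (fst z) (snd z)) / ln (real n)))"
proof -
  obtain a C \<kappa> :: real where a: "a > 0" and C: "C \<ge> 0" and \<kappa>: "\<kappa> > 0" and mix: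
    "\<And>n g A B. g \<ge> 1 \<Longrightarrow> A \<in> coord_sigma 0 (enat n) \<Longrightarrow> B \<in> coord_sigma (n + g) \<infinity> \<Longrightarrow>
      prob (A \<inter> B) \<le> (1 + real g powr (- a)) * (prob A * prob B) + C * exp (- \<kappa> * real g)"
    using mixing_upper_bound[OF mixing] by blast
  \<comment> \<open>With an eighth of the slack, (1 - 2 \<delta>) - b H / 2 = 2 \<delta>; the
    smallness of \<delta> also gives 2 \<delta> < 1, so that many windows fit.\<close>
  define \<delta> where "\<delta> = (2 - b * H) / 8"
  have bH: "b * H = 2 - 8 * \<delta>" by (simp add: \<delta>_def field_simps)
  have \<delta>: "\<delta> > 0" "\<delta> < 1 / 4"
    using b(2) mult_pos_pos[OF b(1) H] by (auto simp: \<delta>_def)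
  define r where "r l = nat \<lceil>(2 ^ l) powr \<delta>\<rceil>" for l :: nat
  \<comment> \<open>The successor pays for the run lost at the start of a window.\<close>
  define k where "k l = Suc (nat \<lceil>b * ln (2 ^ l)\<rceil>)" for l :: nat
  \<comment> \<open>Windows are spaced by \<open>2 * (k l * r l)\<close>; the factor 4 makes them
    occupy at most half of the available length, leaving room for the summand
    \<open>k l\<close>.\<close>
  define m where "m l = 2 ^ l div (4 * (k l * r l))" for l :: nat
  define K where "K = real CARD('a) * c"
  have K: "K > 0" using c_pos by (simp add: K_def)
  \<comment> \<open>The exponential absorbs k \<le> b ln n + 2, and the factor 1/2 pays for the
    words that are not short.\<close>
  define A where "A = exp (- 2 * H) / 2"
  have A: "A > 0" by (simp add: A_def)
  define Z where "Z x = A * x powr (- (b * H))" for x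
  define F1 where "F1 x = 3 * x powr (- (a * \<delta>))" for x
  define F2 where "F2 x = 5 * (C * exp (- \<kappa> * x powr \<delta>)) / (Z x)\<^sup>2" for x
  \<comment> \<open>This is to be a lower bound for m sqrt Z.\<close>
  define R where "R x = sqrt A / 16 * x powr (2 * \<delta>)" for x
  have sF1: "summable (\<lambda>l :: nat. F1 (2 ^ l))"
    unfolding F1_def using \<delta>(1) a by (intro summable_dyadic[of "\<lambda>x. 3 * x powr (- (a * \<delta>))" "a * \<delta>"]) auto
  \<comment> \<open>The stretched exponential absorbs the inverse square of \<open>Z\<close>, which
    grows only polynomially.\<close>
  have sF2: "summable (\<lambda>l :: nat. F2 (2 ^ l))"
  proof (rule summable_dyadic)
    have "(\<lambda>x. exp (- \<kappa> * x powr \<delta>) / (x powr (- (b * H)))\<^sup>2) \<in> O(\<lambda>x. x powr (- 1))"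
      using \<kappa> \<delta>(1) b H by real_asymp
    then have "(\<lambda>x. (5 * C / A\<^sup>2) * (exp (- \<kappa> * x powr \<delta>) / (x powr (- (b * H)))\<^sup>2)) \<in> O(\<lambda>x. x powr (- 1))"
      using A by (cases "C = 0") (simp, subst landau_o.big.cmult_in_iff, simp_all)
    then show "F2 \<in> O(\<lambda>x. x powr (- 1))"
      by (simp add: F2_def[abs_def] Z_def power_mult_distrib mult_ac)
  qed simp
  have sR: "summable (\<lambda>l :: nat. 4 / R (2 ^ l))"
    using \<delta>(1) A unfolding R_def
    by (intro summable_dyadic[of "\<lambda>x. 4 / (sqrt A / 16 * x powr (2 * \<delta>))" "2 * \<delta>"]) (real_asymp, simp)
  have sR2: "summable (\<lambda>l :: nat. 1 / (R (2 ^ l))\<^sup>2)"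
    using \<delta>(1) A unfolding R_def
    by (intro summable_dyadic[of "\<lambda>x. 1 / (sqrt A / 16 * x powr (2 * \<delta>))\<^sup>2" "4 * \<delta>"]) (real_asymp, simp)
  have k_lim: "filterlim k at_top sequentially"
  proof -
    have "filterlim (\<lambda>l :: nat. b * ln (2 ^ l)) at_top sequentially"
      using b(1) by real_asymp
    then have "filterlim (\<lambda>l. real (k l)) at_top sequentially"
      by (rule filterlim_at_top_mono) (auto simp: k_def intro!: always_eventually; linarith)
    then show ?thesis
      by (simp add: filterlim_sequentially_iff_filterlim_real)
  qed
  \<comment> \<open>In turn: \<open>k l\<close> is at most x^\<delta>; eight window lengths fit into
    x; the contribution of overlong words is at most \<open>Z x\<close>.\<close>
  have ev: "\<forall>\<^sub>F x :: real in at_top. b * ln x + 2 \<le> x powr \<delta>"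
    "\<forall>\<^sub>F x :: real in at_top. 16 * x powr (2 * \<delta>) \<le> x"
    "\<forall>\<^sub>F x :: real in at_top. (2 * x powr (2 * \<delta>) + 1) * (K * exp (- h * x powr \<delta>)) \<le> A * x powr (- (b * H))"
    using \<delta> b H h_pos K A by real_asymp+
  note ev = ev[THEN eventually_compose_filterlim, OF filterlim_dyadic]
  have main: "\<forall>\<^sub>F l in sequentially. m l * (2 * (k l * r l)) + k l \<le> 2 ^ l \<and>
      measure (M \<Otimes>\<^sub>M M) (lower_bad (m l) (r l) (k l)) \<le> F1 (2 ^ l) + F2 (2 ^ l) + 4 / R (2 ^ l) + 1 / (R (2 ^ l))\<^sup>2"
    using eventually_compose_filterlim[OF eventually_collision_ge[OF U] k_lim] ev
  proof eventually_elim
    case (elim l)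
    define x :: real where "x = 2 ^ l"
    note elim = elim[folded x_def]
    have x: "x \<ge> 1" by (simp add: x_def)
    have x\<delta>: "x powr \<delta> \<ge> 1" using x \<delta>(1) by (simp add: ge_one_powr_ge_zero)
    have r: "x powr \<delta> \<le> real (r l)" "real (r l) \<le> x powr \<delta> + 1"
      unfolding r_def x_def[symmetric] using powr_ge_zero[of x \<delta>] by linarith+
    have r1: "r l \<ge> 1" using r(1) x\<delta> by linarith
    have "b * ln x \<ge> 0" using b x by simp
    then have k: "b * ln x + 1 \<le> real (k l)" "real (k l) \<le> b * ln x + 2"
      unfolding k_def x_def[symmetric] by linarith+
    have k1: "k l \<ge> 1" by (simp add: k_def)
    define W where "W = k l * r l"
    have W1: "W \<ge> 1" "W \<ge> k l" using r1 k1 by (auto simp: W_def)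
    have "real W \<le> x powr \<delta> * (2 * x powr \<delta>)"
      unfolding W_def of_nat_mult using k(2) elim(2) r(2) x\<delta> by (intro mult_mono) auto
    also have "\<dots> = 2 * x powr (2 * \<delta>)"
      by (simp add: powr_add[symmetric])
    finally have W: "real W \<le> 2 * x powr (2 * \<delta>)" .
    then have W8: "8 * real W \<le> x" using elim(3) by linarith
    have m_le: "m l * (4 * W) \<le> 2 ^ l" unfolding m_def W_def by simp
    have "x \<le> (real (m l) + 1) * (4 * real W)"
    proof -
      have "(2 :: nat) ^ l < (m l + 1) * (4 * W)"
        using W1(1) unfolding m_def W_def[symmetric] by (metis Suc_eq_plus1 dividend_less_div_times mult_Suc mult_pos_pos zero_less_numeral less_le_trans zero_less_one)
      then have "real (2 ^ l) \<le> real ((m l + 1) * (4 * W))" by (simp only: of_nat_le_iff less_imp_le)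
      then show ?thesis by (simp add: x_def algebra_simps)
    qed
    \<comment> \<open>One window block of length 4 W is at most x / 2, so the rounding in
      \<open>m\<close> costs a factor of at most 2.\<close>
    with W8 have "x \<le> real (m l) * (4 * real W) + x / 2" by (simp add: algebra_simps)
    then have "x \<le> real (m l) * (8 * real W)" by simp
    also have "\<dots> \<le> real (m l) * (16 * x powr (2 * \<delta>))"
      using W by (intro mult_left_mono) auto
    finally have "x / (16 * x powr (2 * \<delta>)) \<le> real (m l)"
      using x by (simp add: divide_le_eq)
    moreover have "x / (16 * x powr (2 * \<delta>)) = x powr (1 - 2 * \<delta>) / 16"
      using x by (simp add: powr_diff)
    ultimately have m: "x powr (1 - 2 * \<delta>) / 16 \<le> real (m l)" by simp
    have "x powr (1 - 2 * \<delta>) > 0" using x by simp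
    with m have m1: "m l \<ge> 1" by (cases "m l") auto
    have fits: "m l * (2 * W) + k l \<le> 2 ^ l"
    proof -
      have "1 * (2 * W) \<le> m l * (2 * W)" using m1 by (rule mult_le_mono1)
      with m_le W1 show ?thesis by linarith
    qed
    have tail: "run_tail (r l) \<le> K * exp (- h * x powr \<delta>)"
      unfolding run_tail_def K_def using r(1) h_pos c_pos by (intro mult_left_mono) auto
    \<comment> \<open>The full collision probability is at least twice \<open>Z x\<close> and the
      long words take at most one \<open>Z x\<close>, so one remains for the short words.\<close>
    have "2 * Z x = exp (- H * (b * ln x + 2))"
      using x by (simp add: Z_def A_def powr_def algebra_simps flip: exp_add)
    also have "\<dots> \<le> exp (- H * real (k l))"
      using k(2) H by simp
    also have "\<dots> \<le> collision (k l)" by (rule elim(1))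
    also have "\<dots> \<le> short_collision (k l) W + (real W + 1) * run_tail (r l)"
      unfolding W_def by (rule collision_le_short_collision)
    also have "(real W + 1) * run_tail (r l) \<le> (2 * x powr (2 * \<delta>) + 1) * (K * exp (- h * x powr \<delta>))"
      using W tail run_tail_nonneg by (intro mult_mono) auto
    also have "\<dots> \<le> Z x" using elim(4) by (simp add: Z_def)
    finally have Z_le: "Z x \<le> short_collision (k l) (k l * r l)" by (simp add: W_def)
    have Z_pos: "Z x > 0" using A x by (simp add: Z_def)
    have R_le: "R x \<le> real (m l) * sqrt (Z x)"
    proof -
      have "sqrt (Z x) = sqrt A * x powr (- (b * H) / 2)"
        using x by (simp add: Z_def real_sqrt_mult powr_half_sqrt[symmetric] powr_powr)
      then have "x powr (1 - 2 * \<delta>) / 16 * sqrt (Z x) = sqrt A / 16 * (x powr (1 - 2 * \<delta>) * x powr (- (b * H) / 2))"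
        by simp
      also have "x powr (1 - 2 * \<delta>) * x powr (- (b * H) / 2) = x powr (2 * \<delta>)"
      proof -
        have "1 - 2 * \<delta> + - (b * H) / 2 = 2 * \<delta>" using bH by (simp add: field_simps)
        then show ?thesis by (simp only: powr_add[symmetric])
      qed
      finally have "R x = x powr (1 - 2 * \<delta>) / 16 * sqrt (Z x)" by (simp add: R_def)
      also have "\<dots> \<le> real (m l) * sqrt (Z x)"
        using m Z_pos by (intro mult_right_mono) auto
      finally show ?thesis .
    qed
    have R_pos: "R x > 0" using A x by (simp add: R_def)
    have "measure (M \<Otimes>\<^sub>M M) (lower_bad (m l) (r l) (k l)) \<le>
        3 * real (r l) powr (- a) + 5 * (C * exp (- \<kappa> * real (r l))) / (Z x)\<^sup>2
        + 4 / (real (m l) * sqrt (Z x)) + 1 / (real (m l) * sqrt (Z x))\<^sup>2"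
      by (rule measure_lower_bad[OF mix a C \<kappa> k1 r1 m1 Z_pos Z_le])
    also have "\<dots> \<le> F1 x + F2 x + 4 / R x + 1 / (R x)\<^sup>2"
    proof (intro add_mono)
      have "real (r l) powr (- a) \<le> (x powr \<delta>) powr (- a)"
        using r(1) x\<delta> a by (intro powr_mono2') auto
      then show "3 * real (r l) powr (- a) \<le> F1 x"
        by (simp add: F1_def powr_powr mult.commute)
      show "5 * (C * exp (- \<kappa> * real (r l))) / (Z x)\<^sup>2 \<le> F2 x"
        unfolding F2_def using C \<kappa> r(1) by (intro divide_right_mono mult_left_mono) auto
      show "4 / (real (m l) * sqrt (Z x)) \<le> 4 / R x"
        using R_le R_pos m1 Z_pos by (intro divide_left_mono mult_pos_pos) auto
      show "1 / (real (m l) * sqrt (Z x))\<^sup>2 \<le> 1 / (R x)\<^sup>2"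
        using R_le R_pos m1 Z_pos
        by (intro divide_left_mono power_mono mult_pos_pos zero_less_power) auto
    qed
    finally show ?case
      using fits by (simp add: x_def W_def)
  qed
  have "AE z in M \<Otimes>\<^sub>M M. \<not> eventually_constant (fst z) \<and> \<not> eventually_constant (snd z) \<and>
      (\<forall>\<^sub>F l in sequentially. z \<notin> lower_bad (m l) (r l) (k l))"
    by (rule AE_eventually_not_bad[OF lower_bad_sets summable_add[OF summable_add[OF summable_add[OF sF1 sF2] sR] sR2]])
      (use main in \<open>auto elim: eventually_mono\<close>)
  then show ?thesis
  proof eventually_elim
    case (elim z)
    have "\<forall>\<^sub>F l in sequentially. b * (real l * ln 2) \<le> real (longest_common_rle (2 ^ l) (fst z) (snd z))"
      using elim[THEN conjunct2, THEN conjunct2] main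
    proof eventually_elim
      case bad: (elim l)
      have "k l - 1 \<le> longest_common_rle (2 ^ l) (fst z) (snd z)"
        using elim bad by (intro longest_common_rle_ge[of _ _ "m l" "r l"]) auto
      then have "b * ln (2 ^ l) \<le> real (longest_common_rle (2 ^ l) (fst z) (snd z))"
        unfolding k_def by linarith
      then show ?case by (simp add: ln_realpow)
    qed
    then show ?case
      using b(1) by (intro liminf_div_ln_ge) (auto simp: longest_common_rle_def longest_common_mono)
  qed
qed

section \<open>Passage to the entropies\<close>

lemma AE_liminf_ge_renyi2:
  assumes mixing: "alpha_mixing_exponential M \<or> (\<exists>a :: real. a > 0 \<and> psi_mixing M (\<lambda>g. real g powr (- a)))"
    and pos: "upper_renyi2 rle_alphabet (rle_law M) > 0"
  shows "AE z in M \<Otimes>\<^sub>M M. 2 / upper_renyi2 rle_alphabet (rle_law M) \<le>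
    liminf (\<lambda>n. ereal (real (longest_common_rle n (fst z) (snd z)) / ln (real n)))"
proof (cases "upper_renyi2 rle_alphabet (rle_law M)")
  case (real U)
  then have U: "U > 0" using pos by simp
  \<comment> \<open>Countably many rates below 2 / U suffice, so that their exceptional null sets
    can be united.\<close>
  define b where "b j = 2 / U * (1 - 1 / real (j + 2))" for j
  have t: "0 < 1 - 1 / real (j + 2)" "1 - 1 / real (j + 2) < 1" for j
    by simp_all
  have b: "b j > 0" "b j < 2 / U" for j
    using mult_pos_pos[OF _ t(1), of "2 / U" j] mult_strict_left_mono[OF t(2), of "2 / U" j] U
    by (simp_all add: b_def)
  have "AE z in M \<Otimes>\<^sub>M M.
      ereal (b j) \<le> liminf (\<lambda>n. ereal (real (longest_common_rle n (fst z) (snd z)) / ln (real n)))" for j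
  proof (rule AE_liminf_ge[OF mixing])
    \<comment> \<open>The midpoint of U and 2 / b lies above the entropy and still has product with
      b below 2.\<close>
    have "U < 2 / b j" using b[of j] U by (simp add: field_simps)
    then show "upper_renyi2 rle_alphabet (rle_law M) < ereal ((U + 2 / b j) / 2)"
      by (simp add: real)
    show "b j * ((U + 2 / b j) / 2) < 2"
      using b[of j] U by (simp add: field_simps)
    show "(U + 2 / b j) / 2 > 0"
      using b[of j] U by (simp add: add_pos_pos)
  qed (rule b)
  then have "AE z in M \<Otimes>\<^sub>M M. \<forall>j.
      ereal (b j) \<le> liminf (\<lambda>n. ereal (real (longest_common_rle n (fst z) (snd z)) / ln (real n)))"
    by (simp add: AE_all_countable)
  then show ?thesis
  proof eventually_elim
    case (elim z)
    have "b \<longlonglongrightarrow> 2 / U"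
      unfolding b_def by real_asymp
    then have "(\<lambda>j. ereal (b j)) \<longlonglongrightarrow> ereal (2 / U)" by simp
    then have "ereal (2 / U) \<le> liminf (\<lambda>n. ereal (real (longest_common_rle n (fst z) (snd z)) / ln (real n)))"
      by (rule LIMSEQ_le_const2) (use elim in auto)
    then show ?case
      using U by (simp add: real)
  qed
next
  case PInf
  \<comment> \<open>For infinite entropy the claimed bound is 0. The index 0 is split off because
    \<open>ln\<close> takes a default value there.\<close>
  have "0 \<le> liminf (\<lambda>n. ereal (real (longest_common_rle n x y) / ln (real n)))" for x y :: "nat \<Rightarrow> 'a"
  proof (intro Liminf_bounded always_eventually allI)
    fix n show "0 \<le> ereal (real (longest_common_rle n x y) / ln (real n))"
      by (cases "n = 0") simp_all
  qed
  then show ?thesis by (simp add: PInf)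
next
  case MInf
  with pos show ?thesis by simp
qed

text \<open>Finite and infinite entropy are treated together through rates b decreasing to the
  bound, each admitting some H below the entropy with b H > 2. The conclusion then holds for all
  these rates off one null set.\<close>

lemma AE_limsup_le_renyi2:
  assumes pos: "lower_renyi2 rle_alphabet (rle_law M) > 0"
  shows "AE z in M \<Otimes>\<^sub>M M.
    limsup (\<lambda>n. ereal (real (longest_common_rle n (fst z) (snd z)) / ln (real n)))
      \<le> 2 / lower_renyi2 rle_alphabet (rle_law M)"
proof -
  obtain b B where b: "\<And>j :: nat. b j > 0" "b \<longlonglongrightarrow> B" "ereal B = 2 / lower_renyi2 rle_alphabet (rle_law M)"
    and H: "\<And>j. \<exists>H. ereal H < lower_renyi2 rle_alphabet (rle_law M) \<and> b j * H > 2"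
  proof (cases "lower_renyi2 rle_alphabet (rle_law M)")
    case (real U)
    then have U: "U > 0" using pos by simp
    define b where "b j = 2 / U * (1 + 1 / real (j + 1))" for j :: nat
    have b: "2 / U < b j" for j
      using mult_strict_left_mono[of 1 "1 + 1 / real (j + 1)" "2 / U"] U by (simp add: b_def)
    have b0: "b j > 0" for j
      using b[of j] U by (meson divide_pos_pos less_trans zero_less_numeral)
    show thesis
    proof (rule that[of b "2 / U"])
      show "b \<longlonglongrightarrow> 2 / U"
        unfolding b_def by real_asymp
      \<comment> \<open>Now 2 / b lies below U, and H is again the midpoint.\<close>
      show "\<exists>H. ereal H < lower_renyi2 rle_alphabet (rle_law M) \<and> b j * H > 2" for j
        using b[of j] b0[of j] U by (intro exI[of _ "(U + 2 / b j) / 2"]) (simp add: real field_simps)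
    qed (use b0 real U in auto)
  next
    case PInf
    show thesis
    proof (rule that[of "\<lambda>j. 1 / real (j + 1)" 0])
      show "(\<lambda>j. 1 / real (j + 1)) \<longlonglongrightarrow> 0" by real_asymp
      \<comment> \<open>Every real H lies below an infinite entropy; the chosen one makes the
        product 3.\<close>
      show "\<exists>H. ereal H < lower_renyi2 rle_alphabet (rle_law M) \<and> 1 / real (j + 1) * H > 2" for j
        by (intro exI[of _ "3 * real (j + 1)"]) (simp add: PInf field_simps)
    qed (auto simp: PInf zero_ereal_def)
  qed (use pos in auto)
  have "AE z in M \<Otimes>\<^sub>M M. \<forall>j.
      limsup (\<lambda>n. ereal (real (longest_common_rle n (fst z) (snd z)) / ln (real n))) \<le> ereal (b j)"
    unfolding AE_all_countable using AE_limsup_le b(1) H by blast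
  then show ?thesis
  proof eventually_elim
    case (elim z)
    from b(2) have "(\<lambda>j. ereal (b j)) \<longlonglongrightarrow> ereal B" by simp
    then have "limsup (\<lambda>n. ereal (real (longest_common_rle n (fst z) (snd z)) / ln (real n))) \<le> ereal B"
      by (rule LIMSEQ_le_const) (use elim in auto)
    then show ?case by (simp add: b(3))
  qed
qed

end

theorem theorem2p6:
  fixes M :: "(nat \<Rightarrow> 'a::finite) measure"
  assumes stationary: "stationary_process M"
    and entropy: "lower_renyi2 rle_alphabet (rle_law M) > 0"
    and runs: "\<exists>c h :: real. c > 0 \<and> h > 0 \<and>
      (\<forall>n\<ge>1. \<forall>a. word_prob M (replicate n a) \<le> c * exp (- h * real n))"
    and mixing: "alpha_mixing_exponential M \<or>
      (\<exists>a :: real. a > 0 \<and> psi_mixing M (\<lambda>g. real g powr (- a)))"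
  shows "(AE (x, y) in M \<Otimes>\<^sub>M M.
        liminf (\<lambda>n. ereal (real (longest_common_rle n x y) / ln (real n)))
          \<ge> 2 / upper_renyi2 rle_alphabet (rle_law M)) \<and>
    (\<forall>H :: ereal. lower_renyi2 rle_alphabet (rle_law M) = H \<and>
        upper_renyi2 rle_alphabet (rle_law M) = H \<longrightarrow>
      (AE (x, y) in M \<Otimes>\<^sub>M M.
        (\<lambda>n. ereal (real (longest_common_rle n x y) / ln (real n))) \<longlonglongrightarrow> 2 / H))"
proof -
  obtain c h :: real where ch: "c > 0" "h > 0"
    "\<And>n a. n \<ge> 1 \<Longrightarrow> word_prob M (replicate n a) \<le> c * exp (- h * real n)"
    using runs by blast
  interpret exponential_run_source M c h
    by unfold_locales (use stationary ch in auto)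
  let ?lo = "lower_renyi2 rle_alphabet (rle_law M)" and ?up = "upper_renyi2 rle_alphabet (rle_law M)"
  \<comment> \<open>This passes positivity on to the upper entropy, as
    \<open>AE_liminf_ge_renyi2\<close> requires.\<close>
  have "?lo \<le> ?up"
    unfolding lower_renyi2_def upper_renyi2_def by (rule Liminf_le_Limsup) simp
  then have lower: "AE z in M \<Otimes>\<^sub>M M. 2 / ?up \<le>
      liminf (\<lambda>n. ereal (real (longest_common_rle n (fst z) (snd z)) / ln (real n)))"
    using entropy by (intro AE_liminf_ge_renyi2[OF mixing]) auto
  \<comment> \<open>\<open>H\<close> is an extended real, so infinite entropy with limit 0 is
    included.\<close>
  have "AE z in M \<Otimes>\<^sub>M M.
      (\<lambda>n. ereal (real (longest_common_rle n (fst z) (snd z)) / ln (real n))) \<longlonglongrightarrow> 2 / H"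
    if "?lo = H" "?up = H" for H
    using lower AE_limsup_le_renyi2[OF entropy]
  proof eventually_elim
    case (elim z)
    let ?f = "\<lambda>n. ereal (real (longest_common_rle n (fst z) (snd z)) / ln (real n))"
    have "liminf ?f \<le> limsup ?f" by (rule Liminf_le_Limsup) simp
    with elim show ?case
      unfolding that by (subst tendsto_iff_Liminf_eq_Limsup) auto
  qed
  with lower show ?thesis
    by (simp add: case_prod_beta)
qed

end
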